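(* Let $(W,S)$ be a Coxeter system and $\lambda$ a nearly-maximal labelling of a staircase diagram $\mathcal D$ on its Coxeter–Dynkin graph. Then $$\operatorname{bp}(\Lambda(\mathcal D))=\bigcup_{B\in\max(\mathcal D)}\operatorname{bp}(\lambda(B))\setminus J_R(B),$$ where $\max(\mathcal D)$ is the set of maximal blocks of $\mathcal D$.
   Context: Coxeter–Dynkin graph on $S$ with $s\sim t$ iff $m_{st}\ge3$. For $J\subseteq S$: $W_J$, $W^J$ minimal length left coset representatives, $u_J$ longest element of $W_J$ when finite. $D_L,D_R$ descent sets, $S(w)$ support. BP decomposition of $w$ with respect to $J$: the parabolic decomposition $w=vu$, $v\in W^J,u\in W_J$, when $S(v)\cap J\subseteq D_L(u)$; Grassmannian if $|J|=|S(w)|-1$. For $w\in W$, $\operatorname{bp}(w)=\{s\in S: w$ has a BP decomposition with respect to $S\setminus\{s\}\}$. $w$ is maximal if $w=u_{S(w)}$; a non-maximal $w$ is nearly-maximal if it has a Grassmannian BP decomposition $w=vu$ with $S(u)\subset S(v)$. Staircase diagram: poset $(\mathcal D,\preceq)$ of nonempty subsets (blocks) of $S$ with: (1) each block connected, and if $B$ covers $B'$ then $B\cup B'$ connected; (2) $\mathcal D_s=\{B:s\in B\}$ a chain; (3) if $s\sim t$, $\mathcal D_s\cup\mathcal D_t$ a chain in which $\mathcal D_s,\mathcal D_t$ are saturated; (4) each $B$ is the minimum of some $\mathcal D_s$ and maximum of some $\mathcal D_{s'}$. $J_R(B)=\{s\in B: B\ne\min\mathcal D_s\}$, $J_L(B)=\{s\in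 B: B\ne\max\mathcal D_s\}$. Labelling: $\lambda:\mathcal D\to W$ (with these sets spherical) such that $J_R(B)\subseteq D_R(\lambda(B))$, $J_L(B)\subseteq D_L(\lambda(B))$, $S(\lambda(B)u_{J_R(B)})=S(u_{J_L(B)}\lambda(B))=B$; nearly-maximal if each $\lambda(B)$ is maximal or nearly-maximal. $\Lambda(\mathcal D)=\overline\lambda(B_n)\cdots\overline\lambda(B_1)$ with $\overline\lambda(B)=\lambda(B)u_{J_R(B)}$ for any linear extension $B_1,\dots,B_n$.
   Formalization: Here bp(w) contains only s in the support S(w), and Grassmannian decompositions require J ⊆ S(w); with all s in S the claim fails for A2, blocks {1}<{2}, labels s1, s2, and without J ⊆ S(w) it fails for A3, blocks {1,2}<{3}, labels s1s2, s3. *)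

theory Defs
  imports "HOL-Algebra.Generated_Groups" "HOL-Library.Extended_Nat"
begin

section \<open>Coxeter systems\<close>

definition word_prod :: "('a, 'b) monoid_scheme \<Rightarrow> 'a list \<Rightarrow> 'a" where
  "word_prod G ws = foldr (\<otimes>\<^bsub>G\<^esub>) ws \<one>\<^bsub>G\<^esub>"

text \<open>
  The congruence on words in \<open>S\<close> generated by the Coxeter relations
  \<open>(st)\<^bsup>m(s,t)\<^esup> = 1\<close>; there is no relation when \<open>m s t = \<infinity>\<close>. As
  \<open>m s s = 1\<close>, the relations contain \<open>ss = 1\<close>. Words without inverse letters are
  therefore enough: the quotient monoid is the group with this presentation.
\<close>

inductive coxeter_cong :: "'a set \<Rightarrow> ('a \<Rightarrow> 'a \<Rightarrow> enat) \<Rightarrow> 'a list \<Rightarrow> 'a list \<Rightarrow> bool"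
  for S :: "'a set" and m :: "'a \<Rightarrow> 'a \<Rightarrow> enat"
where
  relator: "s \<in> S \<Longrightarrow> t \<in> S \<Longrightarrow> m s t = enat k \<Longrightarrow>
              coxeter_cong S m (concat (replicate k [s, t])) []"
| refl: "us \<in> lists S \<Longrightarrow> coxeter_cong S m us us"
| sym: "coxeter_cong S m us vs \<Longrightarrow> coxeter_cong S m vs us"
| trans: "coxeter_cong S m us vs \<Longrightarrow> coxeter_cong S m vs ws \<Longrightarrow> coxeter_cong S m us ws"
| append: "coxeter_cong S m us vs \<Longrightarrow> as \<in> lists S \<Longrightarrow> bs \<in> lists S \<Longrightarrow>
              coxeter_cong S m (as @ us @ bs) (as @ vs @ bs)"

text \<open>
  The last assumption says that \<open>G\<close> is presented by the Coxeter relations: they hold in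
  \<open>G\<close>, and every relation between words in \<open>S\<close> follows from them. The set \<open>S\<close> is
  not required to be finite.
\<close>

locale coxeter_system = group G for G (structure) +
  fixes S :: "'a set" and m :: "'a \<Rightarrow> 'a \<Rightarrow> enat"
  assumes S_subset: "S \<subseteq> carrier G"
    and m_diag: "\<And>s. s \<in> S \<Longrightarrow> m s s = 1"
    and m_sym: "\<And>s t. s \<in> S \<Longrightarrow> t \<in> S \<Longrightarrow> m s t = m t s"
    and m_off_diag: "\<And>s t. s \<in> S \<Longrightarrow> t \<in> S \<Longrightarrow> s \<noteq> t \<Longrightarrow> m s t \<ge> 2"
    and generated: "generate G S = carrier G"
    and presented: "\<And>us vs. us \<in> lists S \<Longrightarrow> vs \<in> lists S \<Longrightarrow>
          word_prod G us = word_prod G vs \<longleftrightarrow> coxeter_cong S m us vs"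

definition cox_length :: "('a, 'b) monoid_scheme \<Rightarrow> 'a set \<Rightarrow> 'a \<Rightarrow> nat" where
  "cox_length G S w = (LEAST n. \<exists>ws\<in>lists S. length ws = n \<and> word_prod G ws = w)"

definition reduced_word :: "('a, 'b) monoid_scheme \<Rightarrow> 'a set \<Rightarrow> 'a list \<Rightarrow> 'a \<Rightarrow> bool" where
  "reduced_word G S ws w \<longleftrightarrow>
     ws \<in> lists S \<and> word_prod G ws = w \<and> length ws = cox_length G S w"

definition supp :: "('a, 'b) monoid_scheme \<Rightarrow> 'a set \<Rightarrow> 'a \<Rightarrow> 'a set" where
  "supp G S w = {s. \<exists>ws. reduced_word G S ws w \<and> s \<in> set ws}"

definition left_descents :: "('a, 'b) monoid_scheme \<Rightarrow> 'a set \<Rightarrow> 'a \<Rightarrow> 'a set" where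
  "left_descents G S w = {s \<in> S. cox_length G S (s \<otimes>\<^bsub>G\<^esub> w) < cox_length G S w}"

definition right_descents :: "('a, 'b) monoid_scheme \<Rightarrow> 'a set \<Rightarrow> 'a \<Rightarrow> 'a set" where
  "right_descents G S w = {s \<in> S. cox_length G S (w \<otimes>\<^bsub>G\<^esub> s) < cox_length G S w}"

text \<open>The parabolic subgroup \<open>W\<^sub>J\<close> is \<open>generate G J\<close>.\<close>

definition min_coset_reps :: "('a, 'b) monoid_scheme \<Rightarrow> 'a set \<Rightarrow> 'a set \<Rightarrow> 'a set" where
  "min_coset_reps G S J =
     {v \<in> carrier G. \<forall>x \<in> v <#\<^bsub>G\<^esub> generate G J. cox_length G S v \<le> cox_length G S x}"

definition spherical :: "('a, 'b) monoid_scheme \<Rightarrow> 'a set \<Rightarrow> bool" where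
  "spherical G J \<longleftrightarrow> finite (generate G J)"

definition longest_elt :: "('a, 'b) monoid_scheme \<Rightarrow> 'a set \<Rightarrow> 'a set \<Rightarrow> 'a" where
  "longest_elt G S J =
     (THE u. u \<in> generate G J \<and> (\<forall>x \<in> generate G J. cox_length G S x \<le> cox_length G S u))"


section \<open>Billey-Postnikov decompositions\<close>

definition parabolic_decomp ::
  "('a, 'b) monoid_scheme \<Rightarrow> 'a set \<Rightarrow> 'a set \<Rightarrow> 'a \<Rightarrow> 'a \<Rightarrow> 'a \<Rightarrow> bool" where
  "parabolic_decomp G S J w v u \<longleftrightarrow>
     v \<in> min_coset_reps G S J \<and> u \<in> generate G J \<and> w = v \<otimes>\<^bsub>G\<^esub> u"

definition bp_decomp ::
  "('a, 'b) monoid_scheme \<Rightarrow> 'a set \<Rightarrow> 'a set \<Rightarrow> 'a \<Rightarrow> 'a \<Rightarrow> 'a \<Rightarrow> bool" where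
  "bp_decomp G S J w v u \<longleftrightarrow>
     parabolic_decomp G S J w v u \<and> supp G S v \<inter> J \<subseteq> left_descents G S u"

text \<open>
  Here \<open>J\<close> is a subset of the support of \<open>w\<close>: padding \<open>J\<close> with generators outside
  the support does not change the decomposition, so the cardinality condition would
  otherwise be vacuous.
\<close>

definition grassmannian_bp_decomp ::
  "('a, 'b) monoid_scheme \<Rightarrow> 'a set \<Rightarrow> 'a set \<Rightarrow> 'a \<Rightarrow> 'a \<Rightarrow> 'a \<Rightarrow> bool" where
  "grassmannian_bp_decomp G S J w v u \<longleftrightarrow>
     bp_decomp G S J w v u \<and> J \<subseteq> supp G S w \<and> Suc (card J) = card (supp G S w)"

text \<open>
  Only generators in the support of \<open>w\<close> are taken. For \<open>s \<in> S\<close> outside the support,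
  \<open>w = 1 w\<close> is trivially a BP decomposition with respect to \<open>S - {s}\<close>; counting
  such \<open>s\<close> would make \<open>bp\<close> depend on the ambient \<open>S\<close>, e.g. \<open>bp(1) = S\<close>.
\<close>

definition bp :: "('a, 'b) monoid_scheme \<Rightarrow> 'a set \<Rightarrow> 'a \<Rightarrow> 'a set" where
  "bp G S w = {s \<in> supp G S w. \<exists>v u. bp_decomp G S (S - {s}) w v u}"

definition maximal_elt :: "('a, 'b) monoid_scheme \<Rightarrow> 'a set \<Rightarrow> 'a \<Rightarrow> bool" where
  "maximal_elt G S w \<longleftrightarrow> spherical G (supp G S w) \<and> w = longest_elt G S (supp G S w)"

definition nearly_maximal_elt :: "('a, 'b) monoid_scheme \<Rightarrow> 'a set \<Rightarrow> 'a \<Rightarrow> bool" where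
  "nearly_maximal_elt G S w \<longleftrightarrow>
     \<not> maximal_elt G S w \<and>
     (\<exists>J v u. grassmannian_bp_decomp G S J w v u \<and> supp G S u \<subset> supp G S v)"


section \<open>Staircase diagrams\<close>

definition cox_adj :: "('a \<Rightarrow> 'a \<Rightarrow> enat) \<Rightarrow> 'a \<Rightarrow> 'a \<Rightarrow> bool" where
  "cox_adj m s t \<longleftrightarrow> m s t \<ge> 3"

definition cox_connected :: "('a \<Rightarrow> 'a \<Rightarrow> enat) \<Rightarrow> 'a set \<Rightarrow> bool" where
  "cox_connected m B \<longleftrightarrow>
     (\<forall>s\<in>B. \<forall>t\<in>B. (s, t) \<in> {(a, b). a \<in> B \<and> b \<in> B \<and> cox_adj m a b}\<^sup>*)"

text \<open>A pair \<open>(B', B) \<in> r\<close> stands for \<open>B' \<preceq> B\<close>.\<close>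

definition covers :: "'c set \<Rightarrow> 'c rel \<Rightarrow> 'c \<Rightarrow> 'c \<Rightarrow> bool" where
  "covers D r B B' \<longleftrightarrow>
     B \<in> D \<and> B' \<in> D \<and> (B', B) \<in> r \<and> B' \<noteq> B \<and>
     (\<forall>C\<in>D. (B', C) \<in> r \<and> (C, B) \<in> r \<longrightarrow> C = B' \<or> C = B)"

definition is_chain :: "'c rel \<Rightarrow> 'c set \<Rightarrow> bool" where
  "is_chain r C \<longleftrightarrow> (\<forall>x\<in>C. \<forall>y\<in>C. (x, y) \<in> r \<or> (y, x) \<in> r)"

definition saturated_in :: "'c rel \<Rightarrow> 'c set \<Rightarrow> 'c set \<Rightarrow> bool" where
  "saturated_in r C' C \<longleftrightarrow>
     C' \<subseteq> C \<and> (\<forall>x\<in>C'. \<forall>y\<in>C'. \<forall>z\<in>C. (x, z) \<in> r \<and> (z, y) \<in> r \<longrightarrow> z \<in> C')"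

definition is_minimum :: "'c rel \<Rightarrow> 'c set \<Rightarrow> 'c \<Rightarrow> bool" where
  "is_minimum r C x \<longleftrightarrow> x \<in> C \<and> (\<forall>y\<in>C. (x, y) \<in> r)"

definition is_maximum :: "'c rel \<Rightarrow> 'c set \<Rightarrow> 'c \<Rightarrow> bool" where
  "is_maximum r C x \<longleftrightarrow> x \<in> C \<and> (\<forall>y\<in>C. (y, x) \<in> r)"

definition blocks_at :: "'a set set \<Rightarrow> 'a \<Rightarrow> 'a set set" where
  "blocks_at D s = {B \<in> D. s \<in> B}"

definition staircase_diagram ::
  "'a set \<Rightarrow> ('a \<Rightarrow> 'a \<Rightarrow> enat) \<Rightarrow> 'a set set \<Rightarrow> 'a set rel \<Rightarrow> bool" where
  "staircase_diagram S m D r \<longleftrightarrow>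
     partial_order_on D r \<and>
     (\<forall>B\<in>D. B \<noteq> {} \<and> B \<subseteq> S) \<and>
     (\<forall>B\<in>D. cox_connected m B) \<and>
     (\<forall>B B'. covers D r B B' \<longrightarrow> cox_connected m (B \<union> B')) \<and>
     (\<forall>s\<in>S. is_chain r (blocks_at D s)) \<and>
     (\<forall>s\<in>S. \<forall>t\<in>S. cox_adj m s t \<longrightarrow>
        is_chain r (blocks_at D s \<union> blocks_at D t) \<and>
        saturated_in r (blocks_at D s) (blocks_at D s \<union> blocks_at D t) \<and>
        saturated_in r (blocks_at D t) (blocks_at D s \<union> blocks_at D t)) \<and>
     (\<forall>B\<in>D. (\<exists>s\<in>S. is_minimum r (blocks_at D s) B) \<and>
             (\<exists>s\<in>S. is_maximum r (blocks_at D s) B))"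

definition J_R :: "'a set set \<Rightarrow> 'a set rel \<Rightarrow> 'a set \<Rightarrow> 'a set" where
  "J_R D r B = {s \<in> B. \<not> is_minimum r (blocks_at D s) B}"

definition J_L :: "'a set set \<Rightarrow> 'a set rel \<Rightarrow> 'a set \<Rightarrow> 'a set" where
  "J_L D r B = {s \<in> B. \<not> is_maximum r (blocks_at D s) B}"

definition max_blocks :: "'a set set \<Rightarrow> 'a set rel \<Rightarrow> 'a set set" where
  "max_blocks D r = {B \<in> D. \<forall>B'\<in>D. (B, B') \<in> r \<longrightarrow> B' = B}"


section \<open>Labellings\<close>

definition labelling ::
  "('a, 'b) monoid_scheme \<Rightarrow> 'a set \<Rightarrow> 'a set set \<Rightarrow> 'a set rel \<Rightarrow> ('a set \<Rightarrow> 'a) \<Rightarrow> bool" where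
  "labelling G S D r lam \<longleftrightarrow>
     (\<forall>B\<in>D. lam B \<in> carrier G \<and>
        spherical G (J_R D r B) \<and> spherical G (J_L D r B) \<and>
        J_R D r B \<subseteq> right_descents G S (lam B) \<and>
        J_L D r B \<subseteq> left_descents G S (lam B) \<and>
        supp G S (lam B \<otimes>\<^bsub>G\<^esub> longest_elt G S (J_R D r B)) = B \<and>
        supp G S (longest_elt G S (J_L D r B) \<otimes>\<^bsub>G\<^esub> lam B) = B)"

definition nearly_maximal_labelling ::
  "('a, 'b) monoid_scheme \<Rightarrow> 'a set \<Rightarrow> 'a set set \<Rightarrow> 'a set rel \<Rightarrow> ('a set \<Rightarrow> 'a) \<Rightarrow> bool" where
  "nearly_maximal_labelling G S D r lam \<longleftrightarrow>
     labelling G S D r lam \<and>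
     (\<forall>B\<in>D. maximal_elt G S (lam B) \<or> nearly_maximal_elt G S (lam B))"

definition linear_extension :: "'c set \<Rightarrow> 'c rel \<Rightarrow> 'c list \<Rightarrow> bool" where
  "linear_extension D r Bs \<longleftrightarrow>
     set Bs = D \<and> distinct Bs \<and>
     (\<forall>i<length Bs. \<forall>j<length Bs. (Bs ! i, Bs ! j) \<in> r \<longrightarrow> i \<le> j)"

definition lambda_bar ::
  "('a, 'b) monoid_scheme \<Rightarrow> 'a set \<Rightarrow> 'a set set \<Rightarrow> 'a set rel \<Rightarrow> ('a set \<Rightarrow> 'a) \<Rightarrow> 'a set \<Rightarrow> 'a" where
  "lambda_bar G S D r lam B = lam B \<otimes>\<^bsub>G\<^esub> longest_elt G S (J_R D r B)"

text \<open>
  The list \<open>Bs = [B\<^sub>1, \<dots>, B\<^sub>n]\<close> is meant to be a linear extension of the diagram. It is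
  reversed because \<open>B\<^sub>1\<close> contributes the rightmost factor.
\<close>

definition Lambda ::
  "('a, 'b) monoid_scheme \<Rightarrow> 'a set \<Rightarrow> 'a set set \<Rightarrow> 'a set rel \<Rightarrow> ('a set \<Rightarrow> 'a) \<Rightarrow> 'a set list \<Rightarrow> 'a" where
  "Lambda G S D r lam Bs = word_prod G (map (lambda_bar G S D r lam) (rev Bs))"

end

theory Submission
  imports Defs "HOL.Transcendental"
begin

text \<open>
  Let \<open>K\<^sub>s w\<close> be the support of the minimal representative of \<open>w W\<^bsub>S - {s}\<^esub>\<close>. If
  a product \<open>yx\<close> is reduced, then \<open>K\<^sub>s x \<subseteq> K\<^sub>s (yx) \<subseteq> S(y) \<union> K\<^sub>s x\<close>, and a letter of \<open>y\<close>
  adjacent to \<open>K\<^sub>s x\<close> enters \<open>K\<^sub>s (yx)\<close>. If \<open>s \<in> bp(w)\<close>, then \<open>K\<^sub>s w \<subseteq> K\<^sub>t w\<close> for all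
  \<open>t \<in> K\<^sub>s w\<close>. Apply this to \<open>w = \<Lambda>(D)\<close> and \<open>s\<close> with lowest block \<open>B\<close>. Near-maximality
  gives \<open>B \<subseteq> K\<^sub>s w\<close>. If some \<open>C\<close> covers \<open>B\<close>, then \<open>K\<^sub>s w\<close> contains a \<open>t\<close> with lowest
  block \<open>C\<close>; as \<open>K\<^sub>t w\<close> only meets blocks above \<open>C\<close>, it misses the elements of \<open>B\<close> with highest
  block \<open>B\<close>, so \<open>s \<notin> bp(w)\<close>. If \<open>B\<close> is maximal, then \<open>w = \<lambda>(B) x\<close> with \<open>x\<close> left-minimal for \<open>W\<^sub>B\<close> and
  \<open>s \<notin> S(x)\<close>, and the BP condition for \<open>w\<close> at \<open>s\<close> is the one for \<open>\<lambda>(B)\<close>.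
\<close>

text \<open>In the code, K_s w is \<open>qsp s w\<close>. The inclusion drawn from the BP condition
  rests on spreading. Write w = vu. For t in S(v) other than s, K_t u contains t and every left
  descent of u adjacent to K_t u. All letters of S(v) except s are descents of u and S(v) is
  connected, so K_t u must reach a neighbour of s; multiplying by v, whose reduced words end in s,
  then adds all of S(v). The same fact serves nearly-maximal labels, which are products of this
  shape with full S(v).

  A second obstacle is that near-maximality speaks of \<lambda>(B), while the product contains only
  the truncated labels. The missing longest element of J_R(B) has to be split off the product of the
  lower blocks, so J_R(B) must consist of left descents of that product; saturation of the chains
  provides this.

  The Coxeter theory starts from the presentation alone: exchange comes from counting reflections
  along words, and the Tits representation shows that adjacent generators do not commute.\<close>

lemma word_prod_Nil [simp]: "word_prod G [] = \<one>\<^bsub>G\<^esub>"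
  by (simp add: word_prod_def)

lemma word_prod_Cons [simp]: "word_prod G (a # ws) = a \<otimes>\<^bsub>G\<^esub> word_prod G ws"
  by (simp add: word_prod_def)

section \<open>Words, length and the parity of length\<close>

context coxeter_system
begin

abbreviation len :: "'a \<Rightarrow> nat" where "len \<equiv> cox_length G S"
abbreviation reduced :: "'a list \<Rightarrow> 'a \<Rightarrow> bool" where "reduced \<equiv> reduced_word G S"
abbreviation wp :: "'a list \<Rightarrow> 'a" where "wp \<equiv> word_prod G"
abbreviation sp :: "'a \<Rightarrow> 'a set" where "sp \<equiv> supp G S"
abbreviation DL :: "'a \<Rightarrow> 'a set" where "DL \<equiv> left_descents G S"
abbreviation DR :: "'a \<Rightarrow> 'a set" where "DR \<equiv> right_descents G S"

lemma S_closed [simp]: "s \<in> S \<Longrightarrow> s \<in> carrier G"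
  using S_subset by auto

lemma wp_closed [simp]: "set ws \<subseteq> S \<Longrightarrow> wp ws \<in> carrier G"
  by (induction ws) auto

lemma wp_append: "set us \<subseteq> S \<Longrightarrow> set vs \<subseteq> S \<Longrightarrow> wp (us @ vs) = wp us \<otimes> wp vs"
  by (induction us) (auto simp: m_assoc)

lemma wp_power:
  assumes "s \<in> S" "t \<in> S"
  shows "wp (concat (replicate k [s, t])) = (s \<otimes> t) [^] k"
proof (induction k)
  case (Suc k)
  have "wp (concat (replicate (Suc k) [s, t])) = (s \<otimes> t) \<otimes> (s \<otimes> t) [^] k"
    using Suc assms by (simp add: m_assoc)
  also have "\<dots> = (s \<otimes> t) [^] Suc k"
    using assms by (metis S_closed m_closed nat_pow_Suc2)
  finally show ?case .
qed simp

lemma wp_eq_iff: "set us \<subseteq> S \<Longrightarrow> set vs \<subseteq> S \<Longrightarrow> wp us = wp vs \<longleftrightarrow> coxeter_cong S m us vs"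
  using presented by (simp add: lists_eq_set)

lemma relation: "s \<in> S \<Longrightarrow> t \<in> S \<Longrightarrow> m s t = enat k \<Longrightarrow> (s \<otimes> t) [^] k = \<one>"
  using coxeter_cong.relator[of s S t m k] wp_eq_iff[of "concat (replicate k [s, t])" "[]"]
  by (auto simp: wp_power)

lemma gen_sq [simp]: "s \<in> S \<Longrightarrow> s \<otimes> s = \<one>"
  using relation[of s s 1] m_diag[of s] by (simp add: one_enat_def nat_pow_def)

lemma gen_inv [simp]: "s \<in> S \<Longrightarrow> inv s = s"
  by (simp add: inv_equality)

lemma gen_cancel [simp]: "s \<in> S \<Longrightarrow> x \<in> carrier G \<Longrightarrow> s \<otimes> (s \<otimes> x) = x"
  by (simp flip: m_assoc)

lemma gen_cancel_right [simp]: "s \<in> S \<Longrightarrow> x \<in> carrier G \<Longrightarrow> x \<otimes> s \<otimes> s = x"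
  by (simp add: m_assoc)

lemma generate_eq_words:
  assumes "J \<subseteq> S"
  shows "generate G J = wp ` {ws. set ws \<subseteq> J}"
proof (intro equalityI subsetI)
  fix x assume "x \<in> generate G J"
  then show "x \<in> wp ` {ws. set ws \<subseteq> J}"
  proof induction
    case one
    then show ?case by (auto intro: image_eqI[of _ _ "[]"])
  next
    case (incl h)
    then show ?case using assms by (auto intro!: image_eqI[of _ _ "[h]"])
  next
    case (inv h)
    then show ?case using assms by (auto intro!: image_eqI[of _ _ "[h]"])
  next
    case (eng h1 h2)
    then obtain us vs where "set us \<subseteq> J" "set vs \<subseteq> J" "h1 = wp us" "h2 = wp vs" by auto
    then show ?case using assms wp_append[of us vs]
      by (auto intro!: image_eqI[of _ _ "us @ vs"])
  qed
next
  fix x assume "x \<in> wp ` {ws. set ws \<subseteq> J}"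
  then obtain ws where "set ws \<subseteq> J" "x = wp ws" by auto
  then show "x \<in> generate G J"
    by (induction ws arbitrary: x) (auto intro: generate.intros)
qed

lemma ex_reduced:
  assumes "w \<in> carrier G"
  obtains ws where "reduced ws w"
proof -
  obtain ws where "set ws \<subseteq> S" "w = wp ws"
    using assms generated generate_eq_words[of S] by (metis (no_types, lifting) imageE mem_Collect_eq order_refl)
  then have "\<exists>ws\<in>lists S. length ws = length ws \<and> wp ws = w" by auto
  then have "\<exists>n. \<exists>ws\<in>lists S. length ws = n \<and> wp ws = w" by blast
  then have "\<exists>ws\<in>lists S. length ws = len w \<and> wp ws = w"
    unfolding cox_length_def by (rule LeastI_ex)
  then show thesis using that by (auto simp: reduced_word_def)
qed

lemma reducedD:
  assumes "reduced ws w"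
  shows "set ws \<subseteq> S" "wp ws = w" "length ws = len w" "w \<in> carrier G"
  using assms unfolding reduced_word_def lists_eq_set by auto

lemma len_le: "set ws \<subseteq> S \<Longrightarrow> len (wp ws) \<le> length ws"
  unfolding cox_length_def by (rule Least_le) auto

lemma reducedI: "set ws \<subseteq> S \<Longrightarrow> wp ws = w \<Longrightarrow> length ws \<le> len w \<Longrightarrow> reduced ws w"
  using len_le[of ws] by (auto simp: reduced_word_def)

lemma len_one [simp]: "len \<one> = 0"
  using len_le[of "[]"] by simp

lemma len_eq_0: "w \<in> carrier G \<Longrightarrow> len w = 0 \<longleftrightarrow> w = \<one>"
  by (metis ex_reduced len_one length_0_conv reducedD(2,3) word_prod_Nil)

lemma len_mult:
  assumes "x \<in> carrier G" "y \<in> carrier G"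
  shows "len (x \<otimes> y) \<le> len x + len y"
proof -
  obtain us vs where "reduced us x" "reduced vs y" using assms ex_reduced by metis
  then show ?thesis using len_le[of "us @ vs"] reducedD by (metis length_append set_append sup_least wp_append)
qed

lemma wp_rev: "set ws \<subseteq> S \<Longrightarrow> wp (rev ws) = inv (wp ws)"
  by (induction ws) (auto simp: wp_append inv_mult_group)

lemma reduced_rev: "reduced ws w \<Longrightarrow> len (inv w) \<le> len w"
  using len_le[of "rev ws"] reducedD[of ws w] by (simp add: wp_rev)

lemma len_inv [simp]: "w \<in> carrier G \<Longrightarrow> len (inv w) = len w"
  by (metis dual_order.eq_iff ex_reduced inv_closed inv_inv reduced_rev)

text \<open>Every relator has even length, so word length mod 2 is an invariant of the group
  element. Hence multiplication by a generator never preserves \<open>len\<close>.\<close>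

lemma cong_parity: "coxeter_cong S m us vs \<Longrightarrow> even (length us) = even (length vs)"
  by (induction rule: coxeter_cong.induct) (auto simp: length_concat sum_list_replicate)

lemma cong_set: "coxeter_cong S m us vs \<Longrightarrow> set us \<subseteq> S \<and> set vs \<subseteq> S"
  by (induction rule: coxeter_cong.induct) auto

lemma len_parity:
  assumes "set ws \<subseteq> S"
  shows "even (len (wp ws)) = even (length ws)"
proof -
  obtain vs where "reduced vs (wp ws)" using assms ex_reduced by (metis wp_closed)
  then show ?thesis using assms cong_parity[of ws vs] wp_eq_iff[of ws vs] reducedD[of vs "wp ws"] by auto
qed

lemma len_gen [simp]: "s \<in> S \<Longrightarrow> len s = 1"
  using len_parity[of "[s]"] len_le[of "[s]"] by (cases "len s") auto

lemma len_gen_mult_neq: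
  assumes "s \<in> S" "w \<in> carrier G"
  shows "len (s \<otimes> w) \<noteq> len w"
proof -
  obtain ws where ws: "reduced ws w" using assms ex_reduced by metis
  then show ?thesis using len_parity[of "s # ws"] len_parity[of ws] assms reducedD[OF ws] by auto
qed

lemma len_gen_mult_cases:
  assumes "s \<in> S" "w \<in> carrier G"
  shows "len (s \<otimes> w) = Suc (len w) \<or> Suc (len (s \<otimes> w)) = len w"
  using len_mult[of s w] len_mult[of s "s \<otimes> w"] len_gen_mult_neq[of s w] assms by auto

lemma len_mult_gen:
  assumes "s \<in> S" "w \<in> carrier G"
  shows "len (w \<otimes> s) = len (s \<otimes> inv w)"
  using assms len_inv[of "w \<otimes> s"] by (simp add: inv_mult_group)

lemma len_mult_gen_cases:
  assumes "s \<in> S" "w \<in> carrier G"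
  shows "len (w \<otimes> s) = Suc (len w) \<or> Suc (len (w \<otimes> s)) = len w"
  using len_gen_mult_cases[of s "inv w"] assms by (simp add: len_mult_gen)

section \<open>The exchange condition\<close>

text \<open>The truth value of \<open>refl_parity ws r\<close> is the parity of the number of indices \<open>i\<close> with
  \<open>r = s\<^sub>1 \<dots> s\<^sub>i \<dots> s\<^sub>1\<close>, where \<open>ws = [s\<^sub>1, \<dots>, s\<^sub>n]\<close>.\<close>

fun refl_parity :: "'a list \<Rightarrow> 'a \<Rightarrow> bool" where
  "refl_parity [] r = False"
| "refl_parity (s # ws) r = ((r = s) \<noteq> refl_parity ws (s \<otimes> r \<otimes> s))"

text \<open>Cocycle rule: the reflections read off \<open>vs\<close> after the prefix
  \<open>us\<close> are those of \<open>vs\<close> conjugated by \<open>wp us\<close>.\<close>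

lemma refl_parity_append:
  "set us \<subseteq> S \<Longrightarrow> r \<in> carrier G \<Longrightarrow>
   refl_parity (us @ vs) r = (refl_parity us r \<noteq> refl_parity vs (inv (wp us) \<otimes> r \<otimes> wp us))"
proof (induction us arbitrary: r)
  case (Cons s us)
  have "inv (wp (s # us)) \<otimes> r \<otimes> wp (s # us) = inv (wp us) \<otimes> (s \<otimes> r \<otimes> s) \<otimes> wp us"
    using Cons.prems by (simp add: inv_mult_group m_assoc)
  then show ?case using Cons by auto
qed simp

lemma mult_inv_cancel [simp]:
  "g \<in> carrier G \<Longrightarrow> x \<in> carrier G \<Longrightarrow> g \<otimes> (inv g \<otimes> x) = x"
  "g \<in> carrier G \<Longrightarrow> x \<in> carrier G \<Longrightarrow> inv g \<otimes> (g \<otimes> x) = x"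
  by (simp_all flip: m_assoc)

lemma conj_eq_iff:
  assumes "g \<in> carrier G" "x \<in> carrier G" "y \<in> carrier G"
  shows "inv g \<otimes> x \<otimes> g = y \<longleftrightarrow> x = g \<otimes> y \<otimes> inv g"
proof
  assume "inv g \<otimes> x \<otimes> g = y"
  then show "x = g \<otimes> y \<otimes> inv g" using assms by (auto simp: m_assoc)
next
  assume "x = g \<otimes> y \<otimes> inv g"
  then show "inv g \<otimes> x \<otimes> g = y" using assms by (simp add: m_assoc)
qed

text \<open>With \<open>p = s \<otimes> t\<close>, letter number \<open>j\<close> (from 0) of the
  alternating word contributes the reflection \<open>p^j s\<close>. Because \<open>p^k = 1\<close>,
  positions \<open>j\<close> and \<open>j + k\<close> contribute the same reflection, so each is met
  an even number of times.\<close>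

lemma refl_parity_relator:
  assumes st: "s \<in> S" "t \<in> S" and k: "(s \<otimes> t) [^] k = \<one>" and r: "r \<in> carrier G"
  shows "\<not> refl_parity (concat (replicate k [s, t])) r"
proof -
  define p where "p = s \<otimes> t"
  have p[simp]: "p \<in> carrier G" using st by (simp add: p_def)
  have psp: "p \<otimes> (s \<otimes> p) = s" using st by (simp add: p_def m_assoc)
  \<comment> \<open>\<open>s\<close> inverts \<open>p\<close>, so conjugation by \<open>p^i\<close>
    takes \<open>p^e s\<close> to \<open>p^(2i+e) s\<close>; this is the source of the exponent in
    \<open>key\<close>.\<close>
  have sp: "p [^] (i::nat) \<otimes> s \<otimes> p [^] i = s" for i
  proof (induction i)
    case (Suc i)
    have "p [^] Suc i \<otimes> s \<otimes> p [^] Suc i = p \<otimes> (p [^] i \<otimes> s \<otimes> p [^] i) \<otimes> p"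
      using st nat_pow_Suc2[OF p, of i] by (simp add: m_assoc)
    then show ?case using Suc psp st by (simp add: m_assoc)
  qed (use st in auto)
  have cnt: "refl_parity (concat (replicate i [s, t])) r = odd (card {j. j < 2 * i \<and> r = p [^] j \<otimes> s})" for i
  proof (induction i)
    case (Suc i)
    let ?q = "p [^] i"
    let ?r = "inv ?q \<otimes> r \<otimes> ?q"
    have single: "card {j::nat. j = n \<and> P j} = (if P n then 1 else 0)" for n P
    proof -
      have "{j. j = n \<and> P j} = (if P n then {n} else {})" by auto
      then show ?thesis by simp
    qed
    have split: "concat (replicate (Suc i) [s, t]) = concat (replicate i [s, t]) @ [s, t]"
      by (simp only: replicate_Suc replicate_append_same[symmetric] concat_append) simp
    have key: "(?r = p [^] (e::nat) \<otimes> s) = (r = p [^] (2 * i + e) \<otimes> s)" for e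
    proof -
      have "?r = p [^] e \<otimes> s \<longleftrightarrow> r = ?q \<otimes> (p [^] e \<otimes> s) \<otimes> inv ?q"
        using r st conj_eq_iff[of ?q r "p [^] e \<otimes> s"] by simp
      moreover have "?q \<otimes> (p [^] e \<otimes> s) \<otimes> inv ?q = ?q \<otimes> (p [^] e \<otimes> (?q \<otimes> s \<otimes> ?q)) \<otimes> inv ?q"
        by (simp only: sp)
      moreover have "\<dots> = (?q \<otimes> p [^] e \<otimes> ?q) \<otimes> s"
        using st by (simp add: m_assoc)
      moreover have "?q \<otimes> p [^] e \<otimes> ?q = p [^] (2 * i + e)"
        by (simp add: nat_pow_mult) (simp add: mult_2 add.commute add.left_commute)
      ultimately show ?thesis by simp
    qed
    have k0: "(?r = s) = (r = p [^] (2 * i) \<otimes> s)" using key[of 0] st by simp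
    have "(s \<otimes> ?r \<otimes> s = t) = (?r = p \<otimes> s)"
      using st r conj_eq_iff[of s ?r t] unfolding p_def by simp
    then have k1: "(s \<otimes> ?r \<otimes> s = t) = (r = p [^] Suc (2 * i) \<otimes> s)" using key[of 1] by simp
    have "{j. j < 2 * Suc i \<and> r = p [^] j \<otimes> s} = {j. j < 2 * i \<and> r = p [^] j \<otimes> s}
        \<union> ({j. j = 2 * i \<and> r = p [^] j \<otimes> s} \<union> {j. j = Suc (2 * i) \<and> r = p [^] j \<otimes> s})"
      by (auto simp: less_Suc_eq)
    then have "card {j. j < 2 * Suc i \<and> r = p [^] j \<otimes> s} = card {j. j < 2 * i \<and> r = p [^] j \<otimes> s}
        + (card {j. j = 2 * i \<and> r = p [^] j \<otimes> s} + card {j. j = Suc (2 * i) \<and> r = p [^] j \<otimes> s})"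
      by (simp only:) ((subst card_Un_disjoint, simp, simp, force)+, simp)
    moreover have "card {j. j = 2 * i \<and> r = p [^] j \<otimes> s} = (if ?r = s then 1 else 0)"
      unfolding k0 by (rule single)
    moreover have "card {j. j = Suc (2 * i) \<and> r = p [^] j \<otimes> s} = (if s \<otimes> ?r \<otimes> s = t then 1 else 0)"
      unfolding k1 by (rule single)
    moreover have "refl_parity (concat (replicate (Suc i) [s, t])) r =
      (refl_parity (concat (replicate i [s, t])) r \<noteq> ((?r = s) \<noteq> (s \<otimes> ?r \<otimes> s = t)))"
      unfolding split using st r by (subst refl_parity_append) (auto simp: wp_power p_def)
    ultimately show ?case using Suc by auto
  qed simp
  let ?A = "{j. j < k \<and> r = p [^] j \<otimes> s}"
  have shift: "p [^] (j + k) = p [^] j" for j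
    using k nat_pow_mult[OF p, of j k] by (simp add: p_def[symmetric])
  have "{j. j < 2 * k \<and> r = p [^] j \<otimes> s} = ?A \<union> (\<lambda>j. j + k) ` ?A"
  proof (intro equalityI subsetI)
    fix j assume j: "j \<in> {j. j < 2 * k \<and> r = p [^] j \<otimes> s}"
    show "j \<in> ?A \<union> (\<lambda>j. j + k) ` ?A"
    proof (cases "j < k")
      case False
      then show ?thesis using j shift[of "j - k"] by (auto intro!: image_eqI[of _ _ "j - k"])
    qed (use j in auto)
  qed (auto simp: shift)
  moreover have "card (?A \<union> (\<lambda>j. j + k) ` ?A) = card ?A + card ((\<lambda>j. j + k) ` ?A)"
    by (rule card_Un_disjoint) auto
  moreover have "card ((\<lambda>j. j + k) ` ?A) = card ?A" by (intro card_image) (auto simp: inj_on_def)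
  ultimately show ?thesis unfolding cnt by simp
qed

text \<open>By the cocycle rule a common context changes both parities alike, so only the relators
  need checking. The parity thus depends on the group element alone, which lets
  \<open>exchange\<close> compare different words of one element.\<close>

lemma refl_parity_cong:
  "coxeter_cong S m us vs \<Longrightarrow> r \<in> carrier G \<Longrightarrow> refl_parity us r = refl_parity vs r"
proof (induction arbitrary: r rule: coxeter_cong.induct)
  case (relator s t k)
  then show ?case using refl_parity_relator[of s t k r] relation[of s t k] by auto
next
  case (append us vs as bs)
  have sets: "set us \<subseteq> S" "set vs \<subseteq> S" "set as \<subseteq> S" "set bs \<subseteq> S"
    using append cong_set by auto
  have "wp us = wp vs" using append.hyps sets wp_eq_iff by auto
  then show ?case using append sets by (simp add: refl_parity_append)
qed auto

lemma refl_parity_delete: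
  "refl_parity ws r \<Longrightarrow> set ws \<subseteq> S \<Longrightarrow> r \<in> carrier G \<Longrightarrow>
   \<exists>us a vs. ws = us @ a # vs \<and> r \<otimes> wp ws = wp (us @ vs)"
proof (induction ws arbitrary: r)
  case (Cons s ws)
  show ?case
  proof (cases "r = s")
    case True
    then have "r \<otimes> wp (s # ws) = wp ([] @ ws)" using Cons.prems by simp
    then show ?thesis by blast
  next
    case False
    then have "refl_parity ws (s \<otimes> r \<otimes> s)" using Cons.prems by simp
    then obtain us a vs where *: "ws = us @ a # vs" "s \<otimes> r \<otimes> s \<otimes> wp ws = wp (us @ vs)"
      using Cons.IH[of "s \<otimes> r \<otimes> s"] Cons.prems by auto
    have "set ws \<subseteq> S" "s \<in> S" using Cons.prems by auto
    then have "s \<otimes> (s \<otimes> r \<otimes> s \<otimes> wp ws) = r \<otimes> wp (s # ws)"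
      using Cons.prems(3) by (simp add: m_assoc)
    then have "r \<otimes> wp (s # ws) = wp ((s # us) @ vs)" using * by simp
    moreover have "s # ws = (s # us) @ a # vs" using * by simp
    ultimately show ?thesis by blast
  qed
qed simp

text \<open>An odd parity at \<open>t\<close> lets a letter be deleted. For a reduced word
  \<open>vs\<close> of \<open>t w\<close> the parity at \<open>t\<close> is even, since a deletion
  would make \<open>w\<close> shorter than \<open>t w\<close>. Prepending \<open>t\<close> flips it,
  and \<open>t # vs\<close> represents the same element as \<open>ws\<close>, so it is odd for
  \<open>ws\<close>, reduced or not.\<close>

lemma exchange:
  assumes "t \<in> S" "set ws \<subseteq> S" "len (t \<otimes> wp ws) < len (wp ws)"
  obtains us a vs where "ws = us @ a # vs" "t \<otimes> wp ws = wp (us @ vs)"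
proof -
  obtain vs where vs: "reduced vs (t \<otimes> wp ws)" using assms ex_reduced by (metis S_closed m_closed wp_closed)
  note v = reducedD[OF vs]
  have "\<not> refl_parity vs t"
  proof
    assume "refl_parity vs t"
    then obtain us a us' where *: "vs = us @ a # us'" "t \<otimes> wp vs = wp (us @ us')"
      using refl_parity_delete[of vs t] v assms by auto
    then have "wp ws = wp (us @ us')" using v assms by simp
    then have "len (wp ws) \<le> length (us @ us')" using len_le[of "us @ us'"] * v by simp
    then show False using * v assms by simp
  qed
  then have t: "refl_parity (t # vs) t" using assms by simp
  have "coxeter_cong S m (t # vs) ws"
    using v assms wp_eq_iff[of "t # vs" ws] by simp
  then have "refl_parity ws t" using refl_parity_cong[of "t # vs" ws t] assms(1) t S_closed by blast
  then show thesis using refl_parity_delete[of ws t] assms that by auto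
qed

end

section \<open>The contragredient reflection representation\<close>

lemma sin_shift_eq: "sin (\<theta> + \<phi>) = sin (\<theta> - \<phi>) + 2 * cos \<theta> * sin (\<phi>::real)"
  by (simp add: sin_add sin_diff)

text \<open>Twice the Tits bilinear form. The diagonal is set separately so that
  \<open>reflect m s\<close> is an involution for arbitrary \<open>m\<close>; for
  \<open>k = 1\<close> the cosine formula gives the same value.\<close>

definition cox_form :: "('a \<Rightarrow> 'a \<Rightarrow> enat) \<Rightarrow> 'a \<Rightarrow> 'a \<Rightarrow> real" where
  "cox_form m x y = (if x = y then 2 else case m x y of enat k \<Rightarrow> - 2 * cos (pi / real k) | \<infinity> \<Rightarrow> -2)"

text \<open>A function \<open>f\<close> stands for the linear functional with value
  \<open>f x\<close> at the simple root of \<open>x\<close>. In the dual space every function is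
  admissible, so an infinite \<open>S\<close> needs no finite-support condition.\<close>

definition reflect :: "('a \<Rightarrow> 'a \<Rightarrow> enat) \<Rightarrow> 'a \<Rightarrow> ('a \<Rightarrow> real) \<Rightarrow> 'a \<Rightarrow> real" where
  "reflect m s f x = f x - cox_form m x s * f s"

lemma reflect_reflect: "reflect m s (reflect m s f) = f"
  by (auto simp: reflect_def cox_form_def fun_eq_iff)

text \<open>Every \<open>f\<close> lies on a curve \<open>\<phi> \<mapsto> F \<phi>\<close> along which \<open>s\<close> and \<open>t\<close> act as the reflections
  \<open>\<phi> \<mapsto> -\<phi>\<close> and \<open>\<phi> \<mapsto> 2\<theta> - \<phi>\<close>, so that \<open>st\<close> acts as a rotation by \<open>-2\<theta> = -2\<pi>/k\<close>.\<close>

lemma reflect_order: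
  assumes "s \<noteq> t" "m s t = enat k" "m t s = enat k" "k \<ge> 2"
  shows "((\<lambda>f. reflect m s (reflect m t f)) ^^ k) f = f"
proof -
  define \<theta> where "\<theta> = pi / real k"
  have \<theta>: "0 < \<theta>" "\<theta> < pi"
    using assms by (auto simp: \<theta>_def divide_less_eq)
  then have sin: "sin \<theta> \<noteq> 0" using sin_gt_zero by fastforce
  \<comment> \<open>\<open>(a x, b x)\<close> are the coordinates of the root of \<open>x\<close>
    projected onto the plane of \<open>s\<close> and \<open>t\<close>, with \<open>s\<close> at
    \<open>(1, 0)\<close> and \<open>t\<close> at
    \<open>(- cos \<theta>, sin \<theta>)\<close>.\<close>
  define a where "a x = cox_form m x s / 2" for x
  define b where "b x = (cox_form m x t + cox_form m x s * cos \<theta>) / (2 * sin \<theta>)" for x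
  have vals: "a s = 1" "b s = 0" "a t = - cos \<theta>" "b t = sin \<theta>"
  proof -
    have "2 - 2 * (cos \<theta>)\<^sup>2 = 2 * (sin \<theta>)\<^sup>2" by (simp add: sin_squared_eq)
    then show "a s = 1" "b s = 0" "a t = - cos \<theta>" "b t = sin \<theta>"
      using assms sin by (auto simp: a_def b_def cox_form_def \<theta>_def[symmetric] power2_eq_square divide_eq_eq algebra_simps)
  qed
  \<comment> \<open>\<open>R\<close> and \<open>\<phi>\<close> are polar coordinates of the part of
    \<open>f\<close> seen by \<open>s\<close> and \<open>t\<close>; the remainder \<open>K\<close>
    vanishes at both, so both reflections fix it.\<close>
  obtain R \<phi> where R: "(f t + f s * cos \<theta>) / sin \<theta> = R * cos \<phi>" "f s = R * sin \<phi>"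
    using polar_Ex by blast
  define K where "K x = f x - R * (a x * sin \<phi> + b x * cos \<phi>)" for x
  have K: "K s = 0" "K t = 0"
    using vals R sin by (auto simp: K_def field_simps)
  define F where "F \<psi> = (\<lambda>x. K x + R * (a x * sin \<psi> + b x * cos \<psi>))" for \<psi>
  have Fs: "F \<psi> s = R * sin \<psi>" for \<psi> by (simp add: F_def K vals)
  have Ft: "F \<psi> t = R * sin (\<theta> - \<psi>)" for \<psi> by (simp add: F_def K vals sin_diff algebra_simps)
  have s_act: "reflect m s (F \<psi>) = F (- \<psi>)" for \<psi>
    unfolding reflect_def Fs by (auto simp: F_def a_def fun_eq_iff algebra_simps)
  have t_act: "reflect m t (F \<psi>) = F (2 * \<theta> - \<psi>)" for \<psi>
  proof
    fix x
    have c: "cox_form m x t = 2 * b x * sin \<theta> - 2 * a x * cos \<theta>"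
      using sin by (simp add: a_def b_def field_simps)
    have 1: "sin (2 * \<theta> - \<psi>) - sin \<psi> = 2 * cos \<theta> * sin (\<theta> - \<psi>)"
      using sin_shift_eq[of \<theta> "\<theta> - \<psi>"] by simp
    have "cos (\<theta> + (\<theta> - \<psi>)) - cos (\<theta> - (\<theta> - \<psi>)) = - 2 * sin \<theta> * sin (\<theta> - \<psi>)"
      unfolding cos_add cos_diff by simp
    then have 2: "cos (2 * \<theta> - \<psi>) - cos \<psi> = - 2 * sin \<theta> * sin (\<theta> - \<psi>)" by simp
    have "F (2 * \<theta> - \<psi>) x - F \<psi> x =
        R * (a x * (sin (2 * \<theta> - \<psi>) - sin \<psi>) + b x * (cos (2 * \<theta> - \<psi>) - cos \<psi>))"
      by (simp add: F_def algebra_simps)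
    also have "\<dots> = - cox_form m x t * F \<psi> t"
      unfolding 1 2 c Ft by (simp add: algebra_simps)
    finally show "reflect m t (F \<psi>) x = F (2 * \<theta> - \<psi>) x" by (simp add: reflect_def)
  qed
  have "((\<lambda>f. reflect m s (reflect m t f)) ^^ i) (F \<psi>) = F (\<psi> - 2 * real i * \<theta>)" for i \<psi>
    by (induction i) (auto simp: s_act t_act algebra_simps)
  then have "((\<lambda>f. reflect m s (reflect m t f)) ^^ k) (F \<phi>) = F (\<phi> - 2 * pi)"
    using assms by (simp add: \<theta>_def)
  also have "\<dots> = F \<phi>" by (simp add: F_def sin_diff cos_diff)
  finally show ?thesis by (simp add: F_def K_def)
qed

context coxeter_system
begin

lemma foldr_reflect_relator:
  "foldr (reflect m) (concat (replicate k [s, t])) f = ((\<lambda>f. reflect m s (reflect m t f)) ^^ k) f"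
  by (induction k) auto

lemma reflect_cong:
  "coxeter_cong S m us vs \<Longrightarrow> foldr (reflect m) us f = foldr (reflect m) vs f"
proof (induction arbitrary: f rule: coxeter_cong.induct)
  case (relator s t k)
  show ?case
  proof (cases "s = t")
    case True
    then have "k = 1" using relator m_diag[of s] by (simp add: one_enat_def)
    then show ?thesis using True by (simp add: reflect_reflect)
  next
    case False
    then have "k \<ge> 2" using relator m_off_diag[of s t] by (simp add: numeral_eq_enat)
    then show ?thesis
      unfolding foldr_reflect_relator using relator m_sym[of s t] False reflect_order[of s t m k f] by simp
  qed
qed auto

text \<open>Evaluated at \<open>s\<close> on the indicator function of \<open>t\<close>, the two
  orders of reflection give \<open>c\<close> and \<open>-c\<close> with
  \<open>c = cox_form m s t\<close>, so commuting forces \<open>c = 0\<close>; but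
  \<open>m s t \<ge> 3\<close> makes \<open>c\<close> negative.\<close>

lemma adj_not_commute:
  assumes st: "s \<in> S" "t \<in> S" and adj: "cox_adj m s t"
  shows "s \<otimes> t \<noteq> t \<otimes> s"
proof
  assume eq: "s \<otimes> t = t \<otimes> s"
  have ne: "s \<noteq> t" using adj st m_diag[of s] by (auto simp: cox_adj_def one_enat_def numeral_eq_enat)
  let ?f = "\<lambda>x. if x = t then 1 else 0"
  have "coxeter_cong S m [s, t] [t, s]" using eq st wp_eq_iff[of "[s, t]" "[t, s]"] by simp
  then have "reflect m s (reflect m t ?f) s = reflect m t (reflect m s ?f) s"
    using reflect_cong[of "[s, t]" "[t, s]" ?f] by simp
  then have "cox_form m s t = 0" using ne by (simp add: reflect_def cox_form_def[of m s s])
  moreover have "cox_form m s t < 0"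
  proof (cases "m s t")
    case (enat k)
    then have k: "k \<ge> 3" using adj by (simp add: cox_adj_def numeral_eq_enat)
    then have "pi / real k < pi / 2" by (intro divide_strict_left_mono) auto
    moreover have "0 < pi / real k" using k by simp
    ultimately have "cos (pi / real k) > 0" by (intro cos_gt_zero_pi) auto
    then show ?thesis using ne enat by (simp add: cox_form_def)
  qed (use ne in \<open>simp add: cox_form_def\<close>)
  ultimately show False by simp
qed

lemma not_adj_commute:
  assumes st: "s \<in> S" "t \<in> S" and adj: "\<not> cox_adj m s t"
  shows "s \<otimes> t = t \<otimes> s"
proof (cases "s = t")
  case False
  then have "m s t = enat 2"
    using m_off_diag[OF st] adj by (cases "m s t") (auto simp: cox_adj_def numeral_eq_enat)
  then have "(s \<otimes> t) \<otimes> (s \<otimes> t) = \<one>"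
    using relation[OF st, of 2] st by (simp add: numeral_2_eq_2)
  then have "inv (s \<otimes> t) = s \<otimes> t" using st by (simp add: inv_equality)
  then show ?thesis using st by (simp add: inv_mult_group)
qed simp

lemma adj_sym: "s \<in> S \<Longrightarrow> t \<in> S \<Longrightarrow> cox_adj m s t \<longleftrightarrow> cox_adj m t s"
  by (simp add: cox_adj_def m_sym[of s t])

section \<open>Supports\<close>

text \<open>Prepending a letter to a reduced word either keeps it reduced or, by exchange, deletes a
  letter, so no new letter ever appears.\<close>

lemma words_reduce:
  "set ws \<subseteq> J \<Longrightarrow> J \<subseteq> S \<Longrightarrow> \<exists>vs. reduced vs (wp ws) \<and> set vs \<subseteq> J"
proof (induction ws)
  case Nil
  then show ?case using reducedI[of "[]" \<one>] by fastforce
next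
  case (Cons a ws)
  then obtain vs where vs: "reduced vs (wp ws)" "set vs \<subseteq> J" by auto
  note v = reducedD[OF vs(1)]
  have a: "a \<in> S" "a \<in> J" using Cons.prems by auto
  consider "len (a \<otimes> wp ws) = Suc (len (wp ws))" | "Suc (len (a \<otimes> wp ws)) = len (wp ws)"
    using len_gen_mult_cases[of a "wp ws"] v a by auto
  then show ?case
  proof cases
    case 1
    then have "reduced (a # vs) (a \<otimes> wp ws)" using a v by (intro reducedI) auto
    then show ?thesis using vs a by (intro exI[of _ "a # vs"]) auto
  next
    case 2
    then obtain us b us' where e: "vs = us @ b # us'" "a \<otimes> wp vs = wp (us @ us')"
      using exchange[of a vs] a v by (metis lessI)
    then have "reduced (us @ us') (a \<otimes> wp ws)" using v 2 by (intro reducedI) auto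
    then show ?thesis using vs e by (intro exI[of _ "us @ us'"]) auto
  qed
qed

lemma generate_reduced:
  assumes "J \<subseteq> S" "w \<in> generate G J"
  obtains ws where "reduced ws w" "set ws \<subseteq> J"
proof -
  obtain ws where "w = wp ws" "set ws \<subseteq> J" using assms generate_eq_words[of J] by auto
  then show thesis using words_reduce[of ws J] assms that by auto
qed

lemma generate_closed: "J \<subseteq> S \<Longrightarrow> w \<in> generate G J \<Longrightarrow> w \<in> carrier G"
  using generate_reduced reducedD(4) by metis

lemma generate_mult: "x \<in> generate G J \<Longrightarrow> y \<in> generate G J \<Longrightarrow> x \<otimes> y \<in> generate G J"
  by (rule generate.eng)

lemma generate_inv: "J \<subseteq> S \<Longrightarrow> x \<in> generate G J \<Longrightarrow> inv x \<in> generate G J"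
  by (rule generate_m_inv_closed) auto

lemma wp_in_generate: "set ws \<subseteq> J \<Longrightarrow> J \<subseteq> S \<Longrightarrow> wp ws \<in> generate G J"
  using generate_eq_words by auto

lemma generate_gen_iff:
  assumes "J \<subseteq> S" "s \<in> S"
  shows "s \<in> generate G J \<longleftrightarrow> s \<in> J"
proof
  assume "s \<in> generate G J"
  then obtain ws where ws: "reduced ws s" "set ws \<subseteq> J" using assms generate_reduced by metis
  then have "length ws = 1" using reducedD(3) assms by simp
  then obtain b where "ws = [b]" by (cases ws) auto
  then show "s \<in> J" using ws reducedD[OF ws(1)] by auto
qed (rule generate.incl)

text \<open>The first letter \<open>a\<close> of a reduced word of \<open>w\<close> is a left
  descent; exchange in some word over \<open>J\<close> puts \<open>a w\<close>, hence also
  \<open>a = (a w) w^-1\<close>, into the parabolic subgroup. So all reduced words of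
  \<open>w\<close>, not just one, stay in \<open>J\<close>.\<close>

lemma reduced_in_generate:
  "reduced ws w \<Longrightarrow> w \<in> generate G J \<Longrightarrow> J \<subseteq> S \<Longrightarrow> set ws \<subseteq> J"
proof (induction ws arbitrary: w)
  case (Cons a ws)
  note r = reducedD[OF Cons.prems(1)]
  have a: "a \<in> S" and ws: "set ws \<subseteq> S" and w: "w = a \<otimes> wp ws" using r by auto
  have aw: "a \<otimes> w = wp ws" using a ws w by simp
  then have less: "len (a \<otimes> w) < len w" using len_le[OF ws] r(3) by simp
  obtain vs where vs: "reduced vs w" "set vs \<subseteq> J" using Cons.prems generate_reduced by metis
  obtain us b us' where e: "vs = us @ b # us'" "a \<otimes> w = wp (us @ us')"
    using exchange[of a vs] a less reducedD[OF vs(1)] by metis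
  have y: "a \<otimes> w \<in> generate G J" using e vs Cons.prems wp_in_generate[of "us @ us'" J] by simp
  have "a = (a \<otimes> w) \<otimes> inv w" using a r(4) by (simp add: m_assoc)
  then have "a \<in> generate G J"
    using y Cons.prems generate_mult generate_inv by metis
  then have "a \<in> J" using generate_gen_iff a Cons.prems by blast
  moreover have "reduced ws (wp ws)"
    using ws len_mult[of a "wp ws"] a r w by (intro reducedI) auto
  then have "set ws \<subseteq> J" using Cons.IH y aw Cons.prems by auto
  ultimately show ?case by simp
qed simp

lemma sp_subset_iff:
  assumes "w \<in> carrier G" "J \<subseteq> S"
  shows "sp w \<subseteq> J \<longleftrightarrow> w \<in> generate G J"
proof
  assume "sp w \<subseteq> J"
  moreover obtain ws where ws: "reduced ws w" using assms ex_reduced by metis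
  ultimately have "set ws \<subseteq> J" by (auto simp: supp_def)
  then show "w \<in> generate G J" using wp_in_generate reducedD(2)[OF ws] assms by auto
next
  assume "w \<in> generate G J"
  then show "sp w \<subseteq> J" using reduced_in_generate assms by (auto simp: supp_def)
qed

lemma sp_reduced:
  assumes "reduced ws w"
  shows "sp w = set ws"
proof -
  have "w \<in> generate G (set ws)" using wp_in_generate[of ws "set ws"] reducedD[OF assms] by auto
  then show ?thesis using assms sp_subset_iff[of w "set ws"] reducedD[OF assms] by (auto simp: supp_def)
qed

lemma sp_subset_S [simp]: "w \<in> carrier G \<Longrightarrow> sp w \<subseteq> S"
  using ex_reduced sp_reduced reducedD(1) by metis

lemma finite_sp [simp]: "w \<in> carrier G \<Longrightarrow> finite (sp w)"
  using ex_reduced sp_reduced by (metis List.finite_set)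

lemma in_generate_sp: "w \<in> carrier G \<Longrightarrow> w \<in> generate G (sp w)"
  using sp_subset_iff[of w "sp w"] by simp

lemma sp_one [simp]: "sp \<one> = {}"
  using sp_reduced[of "[]" \<one>] reducedI[of "[]" \<one>] by simp

lemma sp_gen [simp]: "s \<in> S \<Longrightarrow> sp s = {s}"
  using sp_reduced[of "[s]" s] reducedI[of "[s]" s] by simp

lemma sp_mult:
  assumes "x \<in> carrier G" "y \<in> carrier G" "len (x \<otimes> y) = len x + len y"
  shows "sp (x \<otimes> y) = sp x \<union> sp y"
proof -
  obtain us vs where r: "reduced us x" "reduced vs y" using assms ex_reduced by metis
  have "reduced (us @ vs) (x \<otimes> y)"
    using reducedD[OF r(1)] reducedD[OF r(2)] assms wp_append[of us vs] by (intro reducedI) auto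
  then show ?thesis using r sp_reduced by (metis set_append)
qed

lemma sp_mult_subset:
  assumes "x \<in> carrier G" "y \<in> carrier G"
  shows "sp (x \<otimes> y) \<subseteq> sp x \<union> sp y"
proof -
  have "x \<in> generate G (sp x \<union> sp y)" "y \<in> generate G (sp x \<union> sp y)"
    using assms sp_subset_iff[of _ "sp x \<union> sp y"] by auto
  then show ?thesis using assms sp_subset_iff[of "x \<otimes> y" "sp x \<union> sp y"] generate_mult by simp
qed

lemma sp_inv [simp]:
  assumes "w \<in> carrier G"
  shows "sp (inv w) = sp w"
proof -
  obtain ws where ws: "reduced ws w" using assms ex_reduced by metis
  then have "reduced (rev ws) (inv w)" using reducedD[OF ws] wp_rev[of ws] by (intro reducedI) auto
  then show ?thesis using ws sp_reduced by (metis set_rev)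
qed

section \<open>Descents and the exchange condition for products\<close>

lemma DL_iff: "s \<in> DL w \<longleftrightarrow> s \<in> S \<and> len (s \<otimes> w) < len w"
  by (simp add: left_descents_def)

lemma DR_iff: "s \<in> DR w \<longleftrightarrow> s \<in> S \<and> len (w \<otimes> s) < len w"
  by (simp add: right_descents_def)

lemma DR_inv: "w \<in> carrier G \<Longrightarrow> DR w = DL (inv w)"
  by (auto simp: DL_iff DR_iff len_mult_gen)

lemma DL_subset_sp:
  assumes "w \<in> carrier G"
  shows "DL w \<subseteq> sp w"
proof
  fix s assume s: "s \<in> DL w"
  then have sS: "s \<in> S" by (simp add: DL_iff)
  then have "len (s \<otimes> (s \<otimes> w)) = len s + len (s \<otimes> w)"
    using s assms len_gen_mult_cases[of s w] by (auto simp: DL_iff)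
  then show "s \<in> sp w" using sp_mult[of s "s \<otimes> w"] sS assms by auto
qed

lemma DR_subset_sp: "w \<in> carrier G \<Longrightarrow> DR w \<subseteq> sp w"
  using DL_subset_sp[of "inv w"] by (simp add: DR_inv)

lemma len_not_DL: "w \<in> carrier G \<Longrightarrow> t \<in> S \<Longrightarrow> t \<notin> DL w \<Longrightarrow> len (t \<otimes> w) = Suc (len w)"
  using len_gen_mult_cases[of t w] by (auto simp: DL_iff)

text \<open>Exchange is applied to a concatenation of reduced words: the deleted letter lies either
  in the \<open>x\<close> part, so \<open>t\<close> is a descent of \<open>x\<close>, or in the
  \<open>y\<close> part. That \<open>y'\<close> stays in the parabolic of \<open>y\<close> is what
  \<open>conj_support_commute\<close> needs.\<close>

lemma exchange_mult:
  assumes t: "t \<in> S" and xy: "x \<in> carrier G" "y \<in> carrier G" "len (x \<otimes> y) = len x + len y"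
    and less: "len (t \<otimes> (x \<otimes> y)) < len (x \<otimes> y)"
  shows "len (t \<otimes> x) < len x \<or>
    (\<exists>y'\<in>generate G (sp y). t \<otimes> (x \<otimes> y) = x \<otimes> y' \<and> len y' < len y)"
proof -
  obtain us vs where r: "reduced us x" "reduced vs y" using xy ex_reduced by metis
  note u = reducedD[OF r(1)] and v = reducedD[OF r(2)]
  have xy_wp: "wp (us @ vs) = x \<otimes> y" using u v wp_append[of us vs] by simp
  obtain as b bs where e: "us @ vs = as @ b # bs" "t \<otimes> (x \<otimes> y) = wp (as @ bs)"
    using exchange[of t "us @ vs"] t less u(1) v(1) unfolding xy_wp by (metis set_append sup_least)
  consider cs where "us = as @ b # cs" "bs = cs @ vs" | cs where "as = us @ cs" "vs = cs @ b # bs"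
    using e(1) by (auto simp: append_eq_append_conv2 Cons_eq_append_conv append_eq_Cons_conv)
  then show ?thesis
  proof cases
    case 1
    then have "t \<otimes> x \<otimes> y = wp (as @ cs) \<otimes> y"
      using e(2) u v wp_append[of "as @ cs" vs] t xy by (simp add: m_assoc)
    then have "t \<otimes> x = wp (as @ cs)" using xy t u 1 right_cancel[of "t \<otimes> x" "wp (as @ cs)" y] by auto
    then show ?thesis using len_le[of "as @ cs"] u 1 by simp
  next
    case 2
    have "t \<otimes> (x \<otimes> y) = x \<otimes> wp (cs @ bs)"
      using e(2) u v 2 wp_append[of us "cs @ bs"] by simp
    moreover have "wp (cs @ bs) \<in> generate G (sp y)"
      using 2 v sp_reduced[OF r(2)] by (intro wp_in_generate) auto
    moreover have "len (wp (cs @ bs)) < len y" using len_le[of "cs @ bs"] 2 v by simp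
    ultimately show ?thesis by blast
  qed
qed

lemma exchange_mult_right:
  assumes t: "t \<in> S" and xy: "x \<in> carrier G" "y \<in> carrier G" "len (x \<otimes> y) = len x + len y"
    and less: "len (x \<otimes> y \<otimes> t) < len (x \<otimes> y)"
  shows "len (y \<otimes> t) < len y \<or> (\<exists>x'\<in>carrier G. x \<otimes> y \<otimes> t = x' \<otimes> y \<and> len x' < len x)"
proof -
  have i: "inv (x \<otimes> y) = inv y \<otimes> inv x" using xy by (simp add: inv_mult_group)
  have "len (inv y \<otimes> inv x) = len (x \<otimes> y)" unfolding i[symmetric] using xy by simp
  then have add: "len (inv y \<otimes> inv x) = len (inv y) + len (inv x)" using xy by simp
  have "len (t \<otimes> inv (x \<otimes> y)) < len (inv (x \<otimes> y))"
    using less xy t len_mult_gen[of t "x \<otimes> y"] by simp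
  then have "len (t \<otimes> (inv y \<otimes> inv x)) < len (inv y \<otimes> inv x)" unfolding i .
  then consider "len (t \<otimes> inv y) < len (inv y)" |
    z where "z \<in> generate G (sp (inv x))" "t \<otimes> (inv y \<otimes> inv x) = inv y \<otimes> z" "len z < len (inv x)"
    using exchange_mult[OF t _ _ add] xy by auto
  then show ?thesis
  proof cases
    case 1
    then show ?thesis using t xy len_mult_gen[of t y] by simp
  next
    case 2
    have z: "z \<in> carrier G" by (rule generate_closed[OF sp_subset_S 2(1)]) (use xy in simp)
    have "x \<otimes> y \<otimes> t = inv (t \<otimes> inv (x \<otimes> y))" using t xy inv_mult_group[of t "inv (x \<otimes> y)"] by simp
    also have "\<dots> = inv (inv y \<otimes> z)" unfolding i 2(2) ..
    also have "\<dots> = inv z \<otimes> y" using z xy inv_mult_group[of "inv y" z] by simp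
    finally have "x \<otimes> y \<otimes> t = inv z \<otimes> y" .
    moreover have "len (inv z) < len x" using z 2(3) xy by simp
    ultimately show ?thesis using z by blast
  qed
qed

section \<open>Minimal coset representatives\<close>

abbreviation mcr :: "'a set \<Rightarrow> 'a set" where "mcr \<equiv> min_coset_reps G S"

lemma mcr_le: "v \<in> mcr J \<Longrightarrow> u \<in> generate G J \<Longrightarrow> len v \<le> len (v \<otimes> u)"
  by (auto simp: min_coset_reps_def l_coset_def)

lemma mcrI:
  "v \<in> carrier G \<Longrightarrow> (\<And>u. u \<in> generate G J \<Longrightarrow> len v \<le> len (v \<otimes> u)) \<Longrightarrow> v \<in> mcr J"
  by (auto simp: min_coset_reps_def l_coset_def)

lemma mcr_closed [simp]: "v \<in> mcr J \<Longrightarrow> v \<in> carrier G"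
  by (simp add: min_coset_reps_def)

text \<open>If appending \<open>t\<close> to \<open>us\<close> dropped the length after
  \<open>v\<close>, the exchanged letter would come from \<open>v\<close>, giving an
  \<open>x\<close> shorter than \<open>v\<close>. But \<open>x = v (us t us^-1)\<close> lies in the
  coset of \<open>v\<close>.\<close>

lemma mcr_additive:
  assumes J: "J \<subseteq> S" and v: "v \<in> mcr J" and u: "u \<in> generate G J"
  shows "len (v \<otimes> u) = len v + len u"
proof -
  have "reduced us (wp us) \<Longrightarrow> set us \<subseteq> J \<Longrightarrow> len (v \<otimes> wp us) = len v + length us" for us
  proof (induction us rule: rev_induct)
    case (snoc t us)
    have set: "set us \<subseteq> S" "t \<in> S" "t \<in> J" "set us \<subseteq> J" using snoc.prems J by auto
    have split: "wp (us @ [t]) = wp us \<otimes> t" using set by (simp add: wp_append)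
    have l: "len (wp us \<otimes> t) = Suc (length us)" using reducedD[OF snoc.prems(1)] split by simp
    have red: "reduced us (wp us)"
      using l len_mult[of "wp us" t] set by (intro reducedI) auto
    then have IH: "len (v \<otimes> wp us) = len v + len (wp us)" and lus: "len (wp us) = length us"
      using snoc.IH[OF red set(4)] reducedD(3)[OF red] by auto
    have "\<not> len (v \<otimes> wp us \<otimes> t) < len (v \<otimes> wp us)"
    proof
      assume less: "len (v \<otimes> wp us \<otimes> t) < len (v \<otimes> wp us)"
      have "\<not> len (wp us \<otimes> t) < len (wp us)" using l lus by simp
      then obtain x where x: "x \<in> carrier G" "v \<otimes> wp us \<otimes> t = x \<otimes> wp us" "len x < len v"
        using exchange_mult_right[OF set(2) mcr_closed[OF v] wp_closed[OF set(1)] IH less] by blast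
      have "x = x \<otimes> wp us \<otimes> inv (wp us)" using x set by (simp add: m_assoc)
      also have "\<dots> = v \<otimes> (wp us \<otimes> t \<otimes> inv (wp us))"
        unfolding x(2)[symmetric] using set v by (simp add: m_assoc)
      finally have "x = v \<otimes> (wp us \<otimes> t \<otimes> inv (wp us))" .
      moreover have "wp us \<otimes> t \<otimes> inv (wp us) \<in> generate G J"
        using set J by (intro generate_mult generate_inv wp_in_generate generate.incl)
      ultimately show False using mcr_le[OF v] x(3) by fastforce
    qed
    then have "len (v \<otimes> wp us \<otimes> t) = Suc (len (v \<otimes> wp us))"
      using len_mult_gen_cases[of t "v \<otimes> wp us"] set v by auto
    then show ?case using IH lus split set v by (simp add: m_assoc)
  qed (use v in simp)
  then show ?thesis using generate_reduced[OF J u] reducedD by metis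
qed

lemma ex_mcr:
  assumes J: "J \<subseteq> S" and w: "w \<in> carrier G"
  obtains v u where "v \<in> mcr J" "u \<in> generate G J" "w = v \<otimes> u"
proof -
  have "\<one> \<in> generate G J" by (rule generate.one)
  then obtain h where h: "h \<in> generate G J" "\<And>h'. h' \<in> generate G J \<Longrightarrow> len (w \<otimes> h) \<le> len (w \<otimes> h')"
    using ex_has_least_nat[of "\<lambda>h. h \<in> generate G J" \<one> "\<lambda>h. len (w \<otimes> h)"] by blast
  have hc: "h \<in> carrier G" using h J generate_closed by blast
  have "len (w \<otimes> h) \<le> len (w \<otimes> h \<otimes> h')" if "h' \<in> generate G J" for h'
    using h(2)[of "h \<otimes> h'"] that h(1) generate_mult[of h J h'] hc w generate_closed[OF J that]
    by (simp add: m_assoc)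
  then have "w \<otimes> h \<in> mcr J" by (rule mcrI[OF m_closed[OF w hc]])
  moreover have "inv h \<in> generate G J" using generate_inv J h by blast
  moreover have "w = w \<otimes> h \<otimes> inv h" using w hc by (simp add: m_assoc)
  ultimately show thesis using that by blast
qed

lemma last_descent:
  assumes "J \<subseteq> S" "u \<in> generate G J" "u \<noteq> \<one>"
  obtains t where "t \<in> J" "t \<in> DR u"
proof -
  obtain us where us: "reduced us u" "set us \<subseteq> J" using assms generate_reduced by metis
  note r = reducedD[OF us(1)]
  have "us \<noteq> []" using r(2) assms by auto
  then obtain vs t where e: "us = vs @ [t]" by (metis rev_exhaust)
  then have set: "set vs \<subseteq> S" "t \<in> S" "t \<in> J" using us assms by auto
  then have "u \<otimes> t = wp vs" using r(2) e by (auto simp: wp_append)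
  then show thesis using that[of t] set len_le[of vs] r(3) e by (auto simp: DR_iff)
qed

lemma mcr_iff:
  assumes J: "J \<subseteq> S" and v: "v \<in> carrier G"
  shows "v \<in> mcr J \<longleftrightarrow> DR v \<inter> J = {}"
proof
  assume "v \<in> mcr J"
  then show "DR v \<inter> J = {}" using mcr_le[of v J] generate.incl[of _ J G] by (fastforce simp: DR_iff)
next
  assume D: "DR v \<inter> J = {}"
  obtain v0 u where d: "v0 \<in> mcr J" "u \<in> generate G J" "v = v0 \<otimes> u" using ex_mcr[OF J v] by metis
  have u: "u \<in> carrier G" using d J generate_closed by blast
  have "u = \<one>"
  proof (rule ccontr)
    assume "u \<noteq> \<one>"
    then obtain t where t: "t \<in> J" "t \<in> DR u" using last_descent J d by metis
    then have "t \<in> S" by (simp add: DR_iff)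
    then have "len (v \<otimes> t) \<le> len v0 + len (u \<otimes> t)"
      using d u len_mult[of v0 "u \<otimes> t"] by (simp add: m_assoc)
    also have "\<dots> < len v" using t mcr_additive[OF J d(1,2)] d(3) by (simp add: DR_iff)
    finally show False using D t \<open>t \<in> S\<close> by (auto simp: DR_iff)
  qed
  then show "v \<in> mcr J" using d by simp
qed

text \<open>Two minimal representatives of one coset differ by some \<open>z\<close> in
  \<open>W_J\<close>; by additivity each is longer than the other by \<open>len z\<close>, which is
  therefore 0.\<close>

lemma mcr_unique:
  assumes J: "J \<subseteq> S" and v: "v \<in> mcr J" "v' \<in> mcr J" and u: "u \<in> generate G J" "u' \<in> generate G J"
    and eq: "v \<otimes> u = v' \<otimes> u'"
  shows "v = v'"
proof -
  have c: "u \<in> carrier G" "u' \<in> carrier G" using u J generate_closed by auto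
  define z where "z = u \<otimes> inv u'"
  have z: "z \<in> generate G J" "z \<in> carrier G"
    using u J generate_mult generate_inv c by (auto simp: z_def)
  have "v' = v' \<otimes> u' \<otimes> inv u'" using v c by (simp add: m_assoc)
  also have "\<dots> = v \<otimes> z" unfolding eq[symmetric] z_def using v c by (simp add: m_assoc)
  finally have v': "v' = v \<otimes> z" .
  then have "len v' = len v + len z" using mcr_additive J v z by simp
  moreover have "v = v' \<otimes> inv z" using v' v z by (simp add: m_assoc)
  then have "len v = len v' + len z" using mcr_additive[of J v' "inv z"] generate_inv J v z by simp
  ultimately have "z = \<one>" using z len_eq_0 by simp
  then show ?thesis using v' v by simp
qed

text \<open>A right descent \<open>t'\<close> of \<open>t v\<close> in \<open>J\<close> cannot be
  exchanged inside \<open>v\<close>, which is minimal, so the exchange deletes \<open>t\<close> and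
  gives \<open>t v t' = v\<close>.\<close>

lemma deodhar:
  assumes J: "J \<subseteq> S" and v: "v \<in> mcr J" and t: "t \<in> S" and up: "len v < len (t \<otimes> v)"
  shows "t \<otimes> v \<in> mcr J \<or> (\<exists>t'\<in>J. t \<otimes> v = v \<otimes> t')"
proof (rule disjCI)
  assume no: "\<not> (\<exists>t'\<in>J. t \<otimes> v = v \<otimes> t')"
  have "DR (t \<otimes> v) \<inter> J = {}"
  proof (rule ccontr)
    assume "DR (t \<otimes> v) \<inter> J \<noteq> {}"
    then obtain t' where t': "t' \<in> J" "t' \<in> S" "len (t \<otimes> v \<otimes> t') < len (t \<otimes> v)"
      by (auto simp: DR_iff)
    have add: "len (t \<otimes> v) = len t + len v" using up len_gen_mult_cases[of t v] t v by auto
    have "\<not> len (v \<otimes> t') < len v" using mcr_le[OF v generate.incl[OF t'(1)]] by simp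
    then obtain x where x: "x \<in> carrier G" "t \<otimes> v \<otimes> t' = x \<otimes> v" "len x < len t"
      using exchange_mult_right[OF t'(2) S_closed[OF t] mcr_closed[OF v] add t'(3)] by blast
    then have "x = \<one>" using t len_eq_0[of x] by simp
    then have "t \<otimes> v \<otimes> t' = v" using x v by simp
    then have "t \<otimes> v \<otimes> t' \<otimes> t' = v \<otimes> t'" by simp
    then show False using no t t' v by auto
  qed
  then show "t \<otimes> v \<in> mcr J" using mcr_iff J t v by simp
qed

text \<open>Peel off the first letter \<open>r\<close> of a reduced word of an \<open>x\<close>
  commuting with \<open>t\<close>. Since \<open>r t x = (r x) t\<close> is shorter than
  \<open>t x\<close>, exchange gives \<open>r t x = t y\<close> with \<open>y\<close> in the
  parabolic of \<open>x\<close>, so \<open>t r t = y x^-1\<close> avoids \<open>t\<close>. That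
  forces \<open>t r t = r\<close>, and the rest of the word still commutes with
  \<open>t\<close>.\<close>

lemma conj_support_commute:
  assumes t: "t \<in> S" "t \<notin> sp v" and v: "v \<in> carrier G" and t': "t' \<in> S" and eq: "t \<otimes> v = v \<otimes> t'"
  shows "t' = t" "\<forall>r\<in>sp v. r \<otimes> t = t \<otimes> r"
proof -
  have l: "len (t \<otimes> v) = len t + len v" using len_not_DL[of v t] DL_subset_sp t v by auto
  then have "sp (t \<otimes> v) = insert t (sp v)" using sp_mult[of t v] t v by simp
  moreover have "sp (v \<otimes> t') = sp v \<union> {t'}" using sp_mult[of v t'] l eq v t t' by simp
  ultimately show tt: "t' = t" using eq t by auto
  have main: "\<lbrakk>reduced vs x; t \<notin> set vs; t \<otimes> x = x \<otimes> t\<rbrakk> \<Longrightarrow> \<forall>r\<in>set vs. r \<otimes> t = t \<otimes> r" for vs x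
  proof (induction vs arbitrary: x)
    case (Cons r vs)
    note d = reducedD[OF Cons.prems(1)]
    have r: "r \<in> S" "set vs \<subseteq> S" "r \<noteq> t" "t \<notin> set vs" and x: "x = r \<otimes> wp vs" using d Cons.prems by auto
    have spx: "sp x = insert r (set vs)" using sp_reduced[OF Cons.prems(1)] by simp
    have ltx: "len (t \<otimes> x) = len t + len x" using len_not_DL[of x t] DL_subset_sp[of x] t d spx r by auto
    have "r \<otimes> (t \<otimes> x) = wp vs \<otimes> t"
      unfolding Cons.prems(3) using x r t by (simp add: m_assoc)
    then have "len (r \<otimes> (t \<otimes> x)) \<le> len x"
      using len_mult[of "wp vs" t] len_le[of vs] r t d by simp
    then have less: "len (r \<otimes> (t \<otimes> x)) < len (t \<otimes> x)" using ltx t by simp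
    have rt1: "r \<otimes> t \<noteq> \<one>"
    proof
      assume "r \<otimes> t = \<one>"
      then have "r \<otimes> (r \<otimes> t) = r" using r by simp
      then show False using r t by simp
    qed
    then have "\<not> len (r \<otimes> t) < len t" using len_eq_0[of "r \<otimes> t"] r t by simp
    then obtain y where y: "y \<in> generate G (sp x)" "r \<otimes> (t \<otimes> x) = t \<otimes> y"
      using exchange_mult[OF r(1) S_closed[OF t(1)] d(4) ltx less] by blast
    have yc: "y \<in> carrier G" by (rule generate_closed[OF sp_subset_S[OF d(4)] y(1)])
    have lrt: "len (r \<otimes> t) = 2"
      using len_gen_mult_cases[of r t] rt1 len_eq_0[of "r \<otimes> t"] r t by auto
    have "t \<otimes> (r \<otimes> t) = y \<otimes> inv x"
    proof -
      have "t \<otimes> (r \<otimes> t) = t \<otimes> (r \<otimes> (t \<otimes> x)) \<otimes> inv x" using r t d by (simp add: m_assoc)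
      then show ?thesis unfolding y(2) using t yc d by simp
    qed
    then have "t \<otimes> (r \<otimes> t) \<in> generate G (sp x)"
      using y d generate_mult generate_inv[of "sp x"] in_generate_sp[of x] by simp
    then have "sp (t \<otimes> (r \<otimes> t)) \<subseteq> sp x" using sp_subset_iff[of "t \<otimes> (r \<otimes> t)" "sp x"] r t d by simp
    then have "t \<notin> sp (t \<otimes> (r \<otimes> t))" using spx r by auto
    then have "len (t \<otimes> (r \<otimes> t)) < len (r \<otimes> t)"
      using len_gen_mult_cases[of t "r \<otimes> t"] sp_mult[of t "r \<otimes> t"] r t by auto
    moreover have rt: "wp [r, t] = r \<otimes> t" "set [r, t] \<subseteq> S" using r t by simp_all
    ultimately obtain us a us' where e: "[r, t] = us @ a # us'" "t \<otimes> (r \<otimes> t) = wp (us @ us')"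
      using exchange[OF t(1) rt(2)] unfolding rt(1) by blast
    then have "us @ us' = [t] \<or> us @ us' = [r]" by (cases us; cases "tl us") auto
    moreover have "us @ us' \<noteq> [t]"
    proof
      assume "us @ us' = [t]"
      then have "t \<otimes> (t \<otimes> (r \<otimes> t)) = t \<otimes> t" using e t by simp
      then show False using rt1 r t by simp
    qed
    ultimately have "t \<otimes> (r \<otimes> t) = r" using e r by simp
    then have "t \<otimes> (t \<otimes> (r \<otimes> t)) = t \<otimes> r" by simp
    then have comm: "r \<otimes> t = t \<otimes> r" using r t by simp
    have "r \<otimes> (t \<otimes> wp vs) = r \<otimes> (wp vs \<otimes> t)"
      using Cons.prems(3) x r t comm by (simp flip: m_assoc)
    then have "t \<otimes> wp vs = wp vs \<otimes> t" using r t by simp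
    moreover have "reduced vs (wp vs)" using x d r len_mult[of r "wp vs"] by (intro reducedI) auto
    ultimately have "\<forall>s\<in>set vs. s \<otimes> t = t \<otimes> s" using Cons.IH r(4) by blast
    then show ?case using comm unfolding list.set by blast
  qed simp
  obtain vs where "reduced vs v" using v ex_reduced by metis
  then show "\<forall>r\<in>sp v. r \<otimes> t = t \<otimes> r" using main[of vs v] sp_reduced t eq tt by simp
qed

lemma supports_commute:
  assumes "x \<in> carrier G" "y \<in> carrier G"
    and comm: "\<And>s t. s \<in> sp x \<Longrightarrow> t \<in> sp y \<Longrightarrow> s \<otimes> t = t \<otimes> s"
  shows "x \<otimes> y = y \<otimes> x"
proof -
  have one: "s \<otimes> wp ws = wp ws \<otimes> s" if "s \<in> S" "set ws \<subseteq> S" "\<forall>t\<in>set ws. s \<otimes> t = t \<otimes> s" for s ws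
    using that
  proof (induction ws)
    case (Cons t ws)
    have "s \<otimes> (t \<otimes> wp ws) = t \<otimes> (s \<otimes> wp ws)" using Cons.prems by (simp flip: m_assoc)
    then show ?case using Cons by (simp add: m_assoc)
  qed simp
  have two: "wp us \<otimes> y = y \<otimes> wp us" if "set us \<subseteq> S" "\<forall>s\<in>set us. s \<otimes> y = y \<otimes> s" for us
    using that
  proof (induction us)
    case (Cons s us)
    have c: "s \<in> S" "set us \<subseteq> S" "s \<otimes> y = y \<otimes> s" using Cons.prems by auto
    have "s \<otimes> wp us \<otimes> y = s \<otimes> (wp us \<otimes> y)" using c(1,2) assms by (simp add: m_assoc)
    also have "wp us \<otimes> y = y \<otimes> wp us" using Cons by simp
    also have "s \<otimes> (y \<otimes> wp us) = s \<otimes> y \<otimes> wp us" using c(1,2) assms by (simp add: m_assoc)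
    also have "\<dots> = y \<otimes> (s \<otimes> wp us)" unfolding c(3) using c(1,2) assms by (simp add: m_assoc)
    finally show ?case by simp
  qed (use assms in simp)
  obtain us vs where r: "reduced us x" "reduced vs y" using assms ex_reduced by metis
  have "\<forall>s\<in>set us. s \<otimes> y = y \<otimes> s"
  proof
    fix s assume s: "s \<in> set us"
    then show "s \<otimes> y = y \<otimes> s"
      using one[of s vs] comm[of s] reducedD[OF r(1)] reducedD[OF r(2)] sp_reduced[OF r(1)] sp_reduced[OF r(2)]
      by auto
  qed
  then show ?thesis using two[of us] reducedD[OF r(1)] by simp
qed

section \<open>Longest elements\<close>

text \<open>If \<open>t\<close> is a descent of \<open>w = x p\<close> but not of \<open>x\<close>,
  the exchanged letter lies in \<open>p\<close>. So any reduced word over \<open>R\<close> can be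
  split off \<open>w\<close> letter by letter, and every element of \<open>W_R\<close> is a prefix
  of \<open>w\<close>.\<close>

lemma full_descents_left:
  assumes R: "R \<subseteq> S" and w: "w \<in> carrier G" "R \<subseteq> DL w" and x: "x \<in> generate G R"
  shows "len w = len x + len (inv x \<otimes> w)"
proof -
  have "reduced xs (wp xs) \<Longrightarrow> set xs \<subseteq> R \<Longrightarrow> len w = len (wp xs) + len (inv (wp xs) \<otimes> w)" for xs
  proof (induction xs)
    case (Cons t xs)
    have set: "t \<in> S" "t \<in> R" "set xs \<subseteq> S" "set xs \<subseteq> R" using Cons.prems R by auto
    have l: "len (t \<otimes> wp xs) = Suc (length xs)" using reducedD[OF Cons.prems(1)] by simp
    have red: "reduced xs (wp xs)" using l len_mult[of t "wp xs"] set by (intro reducedI) auto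
    define p where "p = inv (wp xs) \<otimes> w"
    have p: "p \<in> carrier G" "w = wp xs \<otimes> p" using set w by (auto simp: p_def)
    have IH: "len (wp xs \<otimes> p) = len (wp xs) + len p" 
      using Cons.IH[OF red set(4)] unfolding p_def[symmetric] p(2)[symmetric] .
    have "t \<in> DL w" using w set by auto
    then have less: "len (t \<otimes> (wp xs \<otimes> p)) < len (wp xs \<otimes> p)"
      unfolding p(2)[symmetric] by (simp add: DL_iff)
    have lxs: "len (wp xs) = length xs" using reducedD[OF red] by simp
    then have "\<not> len (t \<otimes> wp xs) < len (wp xs)" using l by simp
    then obtain q where q: "q \<in> generate G (sp p)" "t \<otimes> (wp xs \<otimes> p) = wp xs \<otimes> q" "len q < len p"
      using exchange_mult[OF set(1) wp_closed[OF set(3)] p(1) IH less] by blast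
    have qc: "q \<in> carrier G" by (rule generate_closed[OF sp_subset_S[OF p(1)] q(1)])
    have "t \<otimes> w = wp xs \<otimes> q" using q(2) p(2) by simp
    then have "t \<otimes> (t \<otimes> w) = t \<otimes> (wp xs \<otimes> q)" by simp
    then have wq: "w = (t \<otimes> wp xs) \<otimes> q" using set w qc by (simp add: m_assoc)
    then have e: "inv (wp (t # xs)) \<otimes> w = q" using set qc by simp
    have "len w \<le> len (t \<otimes> wp xs) + len q" using wq len_mult[of "t \<otimes> wp xs" q] set qc by simp
    then show ?case using e l lxs q(3) IH p(2) by simp
  qed (use w in simp)
  then show ?thesis using generate_reduced[OF R x] reducedD by metis
qed

text \<open>An element of maximal length in \<open>W_J\<close> has every letter of \<open>J\<close>
  as a descent, hence every element of \<open>W_J\<close> as a prefix; a second one of the same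
  length coincides with it. This justifies the \<open>THE\<close>, and the inverse, being equally
  long, is the same element.\<close>

lemma longest_elt_props:
  assumes J: "J \<subseteq> S" and sph: "spherical G J"
  defines "u \<equiv> longest_elt G S J"
  shows "u \<in> generate G J" "J \<subseteq> DL u" "inv u = u"
proof -
  let ?P = "\<lambda>u. u \<in> generate G J \<and> (\<forall>x\<in>generate G J. len x \<le> len u)"
  have ex: "\<exists>u. ?P u"
  proof -
    have fin: "finite (len ` generate G J)" "len ` generate G J \<noteq> {}"
      using sph generate.one[of G J] by (auto simp: spherical_def)
    then obtain u where "u \<in> generate G J" "len u = Max (len ` generate G J)"
      using Max_in[OF fin] by (metis imageE)
    then show ?thesis using Max_ge[OF fin(1)] by auto
  qed
  have DL: "J \<subseteq> DL u" if "?P u" for u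
  proof
    fix t assume t: "t \<in> J"
    have tS: "t \<in> S" "u \<in> carrier G" using t that J generate_closed by auto
    have "len (t \<otimes> u) \<le> len u" using that t generate_mult generate.incl by metis
    then show "t \<in> DL u" using tS len_gen_mult_neq[of t u] by (simp add: DL_iff)
  qed
  have uniq: "x = u" if "?P x" "?P u" for x u
  proof -
    have c: "x \<in> carrier G" "u \<in> carrier G" using that J generate_closed by auto
    have "len u = len x + len (inv x \<otimes> u)" using full_descents_left[OF J] that DL c by auto
    moreover have "len x = len u" using that by (simp add: order_antisym)
    ultimately have "inv x \<otimes> u = \<one>" using len_eq_0 c by simp
    then show ?thesis using c by (metis inv_closed inv_equality inv_inv)
  qed
  have P: "?P u" unfolding u_def longest_elt_def using theI'[of ?P] ex uniq by blast
  then show "u \<in> generate G J" "J \<subseteq> DL u" using DL by auto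
  have "?P (inv u)" using P generate_inv J generate_closed by auto
  then show "inv u = u" using uniq P by blast
qed

lemma full_right_descents_mcr:
  assumes J: "J \<subseteq> S" and sph: "spherical G J" and w: "w \<in> carrier G" "J \<subseteq> DR w"
  defines "u \<equiv> longest_elt G S J"
  shows "len w = len (w \<otimes> u) + len u" "w \<otimes> u \<in> mcr J" "w = w \<otimes> u \<otimes> u"
proof -
  note u = longest_elt_props[OF J sph, folded u_def]
  have uc: "u \<in> carrier G" using u J generate_closed by blast
  have "u \<otimes> u = \<one>" using uc u(3) by (metis r_inv)
  then have w': "w \<otimes> u \<otimes> u = w" using w uc by (simp add: m_assoc)
  then show "w = w \<otimes> u \<otimes> u" by simp
  have "len (inv w) = len u + len (inv u \<otimes> inv w)"
    using full_descents_left[OF J, of "inv w" u] w u by (simp add: DR_inv)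
  moreover have "inv u \<otimes> inv w = inv (w \<otimes> u)" using w uc by (simp add: inv_mult_group)
  ultimately show l: "len w = len (w \<otimes> u) + len u" using w uc by simp
  have "DR (w \<otimes> u) \<inter> J = {}"
  proof (rule ccontr)
    assume "DR (w \<otimes> u) \<inter> J \<noteq> {}"
    then obtain t where t: "t \<in> J" "t \<in> S" "len (w \<otimes> u \<otimes> t) < len (w \<otimes> u)" by (auto simp: DR_iff)
    have "(w \<otimes> u \<otimes> t) \<otimes> (t \<otimes> u) = w \<otimes> u \<otimes> u" using w uc t by (simp add: m_assoc)
    then have "(w \<otimes> u \<otimes> t) \<otimes> (t \<otimes> u) = w" using w' by simp
    then have "len w \<le> len (w \<otimes> u \<otimes> t) + len (t \<otimes> u)"
      using len_mult[of "w \<otimes> u \<otimes> t" "t \<otimes> u"] w uc t by simp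
    moreover have "len (t \<otimes> u) < len u" using u(2) t by (auto simp: DL_iff)
    ultimately show False using l t by simp
  qed
  then show "w \<otimes> u \<in> mcr J" using mcr_iff J w uc by simp
qed

end

lemma cox_connected_closed:
  assumes K: "cox_connected m K" and t: "t \<in> K" "t \<in> X"
    and cl: "\<And>x r. x \<in> X \<Longrightarrow> x \<in> K \<Longrightarrow> r \<in> K \<Longrightarrow> cox_adj m x r \<Longrightarrow> r \<in> X"
  shows "K \<subseteq> X"
proof
  fix r assume "r \<in> K"
  then have "(t, r) \<in> {(a, b). a \<in> K \<and> b \<in> K \<and> cox_adj m a b}\<^sup>*"
    using K t by (simp add: cox_connected_def)
  then show "r \<in> X" by (induction rule: rtrancl_induct) (use t cl in auto)
qed

lemma cox_connected_insert:
  assumes X: "cox_connected m X" and r: "r \<in> X" "cox_adj m a r" "cox_adj m r a"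
  shows "cox_connected m (insert a X)"
proof -
  let ?R = "\<lambda>X. {(a, b). a \<in> X \<and> b \<in> X \<and> cox_adj m a b}"
  have mono: "(?R X)\<^sup>* \<subseteq> (?R (insert a X))\<^sup>*" by (rule rtrancl_mono) auto
  have ar: "(a, r) \<in> (?R (insert a X))\<^sup>*" "(r, a) \<in> (?R (insert a X))\<^sup>*" using r by auto
  have XX: "(x, y) \<in> (?R (insert a X))\<^sup>*" if "x \<in> X" "y \<in> X" for x y
    using X mono that by (auto simp: cox_connected_def)
  show ?thesis
    unfolding cox_connected_def
  proof (intro ballI)
    fix x y assume xy: "x \<in> insert a X" "y \<in> insert a X"
    have "(x, r) \<in> (?R (insert a X))\<^sup>*" using xy(1) XX[of x r] r ar by blast
    moreover have "(r, y) \<in> (?R (insert a X))\<^sup>*" using xy(2) XX[of r y] r ar by blast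
    ultimately show "(x, y) \<in> (?R (insert a X))\<^sup>*" by (rule rtrancl_trans)
  qed
qed

context coxeter_system
begin

section \<open>Supports of minimal representatives modulo maximal parabolic subgroups\<close>

text \<open>The support \<open>qsp s w\<close> of this representative is the K_s w of the overview;
  \<open>mcr_unique\<close> makes the \<open>THE\<close> well defined.\<close>

definition rep :: "'a \<Rightarrow> 'a \<Rightarrow> 'a" where
  "rep s w = (THE v. v \<in> mcr (S - {s}) \<and> (\<exists>u\<in>generate G (S - {s}). w = v \<otimes> u))"

abbreviation qsp :: "'a \<Rightarrow> 'a \<Rightarrow> 'a set" where "qsp s w \<equiv> sp (rep s w)"

lemma rep_eq:
  assumes "v \<in> mcr (S - {s})" "u \<in> generate G (S - {s})"
  shows "rep s (v \<otimes> u) = v"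
  unfolding rep_def
proof (rule the_equality)
  show "v \<in> mcr (S - {s}) \<and> (\<exists>u'\<in>generate G (S - {s}). v \<otimes> u = v \<otimes> u')" using assms by blast
next
  fix v' assume "v' \<in> mcr (S - {s}) \<and> (\<exists>u'\<in>generate G (S - {s}). v \<otimes> u = v' \<otimes> u')"
  then obtain u' where "v' \<in> mcr (S - {s})" "u' \<in> generate G (S - {s})" "v \<otimes> u = v' \<otimes> u'" by blast
  then show "v' = v" using mcr_unique[of "S - {s}" v v' u u'] assms by auto
qed

lemma rep_decomp:
  assumes "w \<in> carrier G"
  obtains u where "rep s w \<in> mcr (S - {s})" "u \<in> generate G (S - {s})" "u \<in> carrier G" "w = rep s w \<otimes> u"
proof -
  obtain v u where "v \<in> mcr (S - {s})" "u \<in> generate G (S - {s})" "w = v \<otimes> u"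
    using ex_mcr[of "S - {s}" w] assms by blast
  then show thesis using that[of u] rep_eq[of v s u] generate_closed[of "S - {s}" u] by auto
qed

lemma rep_mcr: "w \<in> carrier G \<Longrightarrow> rep s w \<in> mcr (S - {s})"
  by (rule rep_decomp)

lemma rep_closed [simp]: "w \<in> carrier G \<Longrightarrow> rep s w \<in> carrier G"
  using mcr_closed[OF rep_mcr] .

lemma qsp_subset_sp:
  assumes "w \<in> carrier G"
  shows "qsp s w \<subseteq> sp w"
proof -
  obtain u where u: "rep s w \<in> mcr (S - {s})" "u \<in> generate G (S - {s})" "u \<in> carrier G" "w = rep s w \<otimes> u"
    using rep_decomp assms by metis
  have "len (rep s w \<otimes> u) = len (rep s w) + len u" using mcr_additive[OF Diff_subset u(1,2)] .
  then have "sp (rep s w \<otimes> u) = qsp s w \<union> sp u" by (rule sp_mult[OF rep_closed[OF assms] u(3)])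
  then show ?thesis unfolding u(4)[symmetric] by blast
qed

text \<open>Parabolic factors are unique, so the existential in \<open>bp\<close> has only one
  candidate and reduces to a descent condition on \<open>u\<close>.\<close>

lemma bp_iff:
  assumes v: "v \<in> mcr (S - {s})" and u: "u \<in> generate G (S - {s})"
  shows "s \<in> bp G S (v \<otimes> u) \<longleftrightarrow> s \<in> sp (v \<otimes> u) \<and> sp v - {s} \<subseteq> DL u"
proof -
  have c: "v \<in> carrier G" "u \<in> carrier G" using v u mcr_closed generate_closed[of "S - {s}"] by auto
  have sub: "sp v \<inter> (S - {s}) = sp v - {s}" using sp_subset_S[OF c(1)] by blast
  have "v' = v \<and> u' = u" if "bp_decomp G S (S - {s}) (v \<otimes> u) v' u'" for v' u'
  proof -
    have d: "v' \<in> mcr (S - {s})" "u' \<in> generate G (S - {s})" "v \<otimes> u = v' \<otimes> u'"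
      using that by (auto simp: bp_decomp_def parabolic_decomp_def)
    then have "v = v'" using mcr_unique[of "S - {s}" v v' u u'] v u by auto
    moreover have "u' \<in> carrier G" using d(2) generate_closed[of "S - {s}"] by auto
    ultimately show ?thesis using d(3) c by simp
  qed
  moreover have "bp_decomp G S (S - {s}) (v \<otimes> u) v u \<longleftrightarrow> sp v - {s} \<subseteq> DL u"
    using v u sub by (auto simp: bp_decomp_def parabolic_decomp_def)
  ultimately show ?thesis unfolding bp_def by blast
qed

lemma mcr_last:
  assumes "v \<in> mcr (S - {s})" "v \<noteq> \<one>"
  shows "s \<in> sp v"
proof -
  have c: "v \<in> carrier G" using assms mcr_closed by blast
  then obtain t where t: "t \<in> S" "t \<in> DR v" using last_descent[of S v] generated assms by auto
  then have "t = s" using mcr_iff[of "S - {s}" v] assms c by auto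
  then show ?thesis using t DR_subset_sp c by auto
qed

text \<open>By Deodhar's lemma, multiplication on the left by \<open>t\<close> either extends the minimal
  representative or passes through it; in the second case \<open>t\<close> is in its support or commutes
  with it.\<close>

lemma qsp_step:
  assumes t: "t \<in> S" and x: "x \<in> carrier G" and up: "len x < len (t \<otimes> x)"
  shows "qsp s (t \<otimes> x) = insert t (qsp s x) \<or>
    qsp s (t \<otimes> x) = qsp s x \<and> (t \<in> qsp s x \<or> t \<noteq> s \<and> (\<forall>r\<in>qsp s x. r \<otimes> t = t \<otimes> r))"
proof -
  let ?J = "S - {s}"
  obtain u where d: "rep s x \<in> mcr ?J" "u \<in> generate G ?J" "u \<in> carrier G" "x = rep s x \<otimes> u"
    using rep_decomp x by metis
  define v where "v = rep s x"
  have v: "v \<in> mcr ?J" "v \<in> carrier G" "x = v \<otimes> u" using d mcr_closed by (auto simp: v_def)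
  have add: "len (v \<otimes> u) = len v + len u" using mcr_additive[of ?J v u] v d by auto
  have tx: "t \<otimes> x = (t \<otimes> v) \<otimes> u" using v d t by (simp add: m_assoc)
  have "len (t \<otimes> x) \<le> len (t \<otimes> v) + len u" unfolding tx using len_mult v d t by simp
  then have upv: "len v < len (t \<otimes> v)" using up add v(3) by simp
  then have ins: "sp (t \<otimes> v) = insert t (sp v)"
    using sp_mult[of t v] len_gen_mult_cases[of t v] t v by auto
  consider "t \<otimes> v \<in> mcr ?J" | t' where "t' \<in> ?J" "t \<otimes> v = v \<otimes> t'"
    using deodhar[of ?J v t] v t upv by auto
  then show ?thesis
  proof cases
    case 1
    then have "rep s (t \<otimes> x) = t \<otimes> v" unfolding tx using rep_eq d by blast
    then show ?thesis using ins by (simp add: v_def)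
  next
    case 2
    have t': "t' \<in> S" "t' \<noteq> s" using 2 by auto
    have "t \<otimes> x = v \<otimes> (t' \<otimes> u)" unfolding tx 2(2) using v d t' by (simp add: m_assoc)
    moreover have "t' \<otimes> u \<in> generate G ?J" using generate_mult generate.incl 2(1) d(2) by metis
    ultimately have r: "rep s (t \<otimes> x) = v" using rep_eq[of v s] v by simp
    show ?thesis
    proof (cases "t \<in> sp v")
      case True
      then show ?thesis using r by (simp add: v_def)
    next
      case False
      then have "t' = t" "\<forall>r\<in>sp v. r \<otimes> t = t \<otimes> r"
        using conj_support_commute[of t v t'] t v t' 2 by auto
      then show ?thesis using r t' by (simp add: v_def)
    qed
  qed
qed

text \<open>Adjacent generators do not commute, which rules out the only branch of
  \<open>qsp_step\<close> that leaves \<open>t\<close> outside.\<close>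

lemma qsp_step_adj:
  assumes "t \<in> S" "x \<in> carrier G" "len x < len (t \<otimes> x)" "r \<in> qsp s x" "cox_adj m t r"
  shows "t \<in> qsp s (t \<otimes> x)"
proof -
  have "r \<in> S" using sp_subset_S[OF rep_closed[OF assms(2)]] assms(4) by blast
  then have "r \<otimes> t \<noteq> t \<otimes> r" using adj_not_commute[of t r] assms by metis
  then show ?thesis using qsp_step[of t x s] assms by blast
qed

lemma qsp_step_self:
  "s \<in> S \<Longrightarrow> x \<in> carrier G \<Longrightarrow> len x < len (s \<otimes> x) \<Longrightarrow> s \<in> qsp s (s \<otimes> x)"
  using qsp_step[of s x s] by blast

lemma additive_Cons:
  assumes "set (a # ys) \<subseteq> S" "x \<in> carrier G" "len (wp (a # ys) \<otimes> x) = length (a # ys) + len x"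
  shows "len (wp ys \<otimes> x) = length ys + len x" "wp (a # ys) \<otimes> x = a \<otimes> (wp ys \<otimes> x)"
    "len (wp ys \<otimes> x) < len (a \<otimes> (wp ys \<otimes> x))"
proof -
  have s: "a \<in> S" "set ys \<subseteq> S" using assms by auto
  show e: "wp (a # ys) \<otimes> x = a \<otimes> (wp ys \<otimes> x)" using s assms by (simp add: m_assoc)
  have l: "len (a \<otimes> (wp ys \<otimes> x)) = Suc (length ys + len x)" using assms(3) e by simp
  have "len (a \<otimes> (wp ys \<otimes> x)) \<le> 1 + len (wp ys \<otimes> x)" using len_mult[of a] s assms by simp
  moreover have "len (wp ys \<otimes> x) \<le> len (wp ys) + len x" using len_mult s assms by simp
  ultimately show "len (wp ys \<otimes> x) = length ys + len x" using l len_le[OF s(2)] by simp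
  then show "len (wp ys \<otimes> x) < len (a \<otimes> (wp ys \<otimes> x))" using l by simp
qed

text \<open>Apply \<open>qsp_step\<close> to the letters of a reduced word of \<open>y\<close> from
  right to left. The support only grows, so \<open>r\<close> is still present when \<open>t\<close>
  is read.\<close>

lemma qsp_mult:
  assumes y: "y \<in> carrier G" and x: "x \<in> carrier G" and add: "len (y \<otimes> x) = len y + len x"
  shows "qsp s x \<subseteq> qsp s (y \<otimes> x)" "qsp s (y \<otimes> x) \<subseteq> sp y \<union> qsp s x"
    "t \<in> sp y \<Longrightarrow> r \<in> qsp s x \<Longrightarrow> cox_adj m t r \<Longrightarrow> t \<in> qsp s (y \<otimes> x)"
proof -
  have main: "\<lbrakk>set ys \<subseteq> S; len (wp ys \<otimes> x) = length ys + len x\<rbrakk> \<Longrightarrow>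
    qsp s x \<subseteq> qsp s (wp ys \<otimes> x) \<and> qsp s (wp ys \<otimes> x) \<subseteq> set ys \<union> qsp s x \<and>
    (\<forall>t\<in>set ys. (\<exists>r\<in>qsp s x. cox_adj m t r) \<longrightarrow> t \<in> qsp s (wp ys \<otimes> x))" for ys
  proof (induction ys)
    case (Cons a ys)
    have set: "a \<in> S" "set ys \<subseteq> S" using Cons.prems by auto
    define z where "z = wp ys \<otimes> x"
    have z: "z \<in> carrier G" using set x by (simp add: z_def)
    note ac = additive_Cons[OF Cons.prems(1) x Cons.prems(2), folded z_def]
    note IH = Cons.IH[OF set(2), folded z_def, OF ac(1)]
    have "qsp s (a \<otimes> z) = insert a (qsp s z) \<or> qsp s (a \<otimes> z) = qsp s z"
      using qsp_step[OF set(1) z ac(3), of s] by blast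
    moreover have "a \<in> qsp s (a \<otimes> z)" if "r \<in> qsp s x" "cox_adj m a r" for r
      using qsp_step_adj[OF set(1) z ac(3), of r s] IH that by blast
    ultimately show ?case unfolding ac(2) list.set using IH by blast
  qed (use x in simp)
  obtain ys where "reduced ys y" using y ex_reduced by metis
  then show "qsp s x \<subseteq> qsp s (y \<otimes> x)" "qsp s (y \<otimes> x) \<subseteq> sp y \<union> qsp s x"
    "t \<in> sp y \<Longrightarrow> r \<in> qsp s x \<Longrightarrow> cox_adj m t r \<Longrightarrow> t \<in> qsp s (y \<otimes> x)"
    using main[of ys] add reducedD[of ys y] sp_reduced[of ys y] by auto
qed

lemma mcr_reduced_singleton:
  assumes "reduced [a] v" "v \<in> mcr (S - {s})"
  shows "a = s"
proof (rule ccontr)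
  assume "a \<noteq> s"
  have a: "a \<in> S" "v = a" using reducedD[OF assms(1)] by auto
  then have "len v \<le> len (v \<otimes> a)" using mcr_le[OF assms(2) generate.incl, of a] \<open>a \<noteq> s\<close> by auto
  then show False using a by simp
qed

text \<open>A right descent of the tail other than \<open>s\<close> would also be one of
  \<open>v\<close>, so the tail is minimal as well. A first letter that neither recurs nor touches
  the tail could be commuted to the end, where only \<open>s\<close> may stand; but \<open>s\<close>
  already occurs in \<open>vs\<close>.\<close>

lemma mcr_reduced_Cons:
  assumes red: "reduced (a # vs) v" and v: "v \<in> mcr (S - {s})" and ne: "vs \<noteq> []"
  shows "reduced vs (wp vs)" "wp vs \<in> mcr (S - {s})" "s \<in> set vs"
    "a \<in> set vs \<or> (\<exists>r\<in>set vs. cox_adj m a r)"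
proof -
  note d = reducedD[OF red]
  have set: "a \<in> S" "set vs \<subseteq> S" and ve: "v = a \<otimes> wp vs" using d by auto
  have lv: "len (a \<otimes> wp vs) = Suc (length vs)" using d ve by simp
  show r': "reduced vs (wp vs)" using lv len_mult[of a "wp vs"] set by (intro reducedI) auto
  then have lvs: "len (wp vs) = length vs" using reducedD(3)[OF r'] by simp
  have "DR (wp vs) \<inter> (S - {s}) = {}"
  proof (rule ccontr)
    assume "DR (wp vs) \<inter> (S - {s}) \<noteq> {}"
    then obtain r where "r \<in> DR (wp vs)" "r \<in> S - {s}" by blast
    then have r: "r \<in> S" "r \<noteq> s" "len (wp vs \<otimes> r) < len (wp vs)" by (auto simp: DR_iff)
    have "len (v \<otimes> r) \<le> 1 + len (wp vs \<otimes> r)"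
      using len_mult[of a "wp vs \<otimes> r"] set r ve by (simp add: m_assoc)
    then have "r \<in> DR v" using r lv lvs ve by (simp add: DR_iff)
    then show False using mcr_iff[of "S - {s}" v] v d(4) r by auto
  qed
  then show m': "wp vs \<in> mcr (S - {s})" using mcr_iff[of "S - {s}" "wp vs"] set by auto
  have "wp vs \<noteq> \<one>" using lvs ne by auto
  then show s: "s \<in> set vs" using mcr_last[OF m'] sp_reduced[OF r'] by simp
  show "a \<in> set vs \<or> (\<exists>r\<in>set vs. cox_adj m a r)"
  proof (rule ccontr)
    assume no: "\<not> (a \<in> set vs \<or> (\<exists>r\<in>set vs. cox_adj m a r))"
    have "a \<otimes> wp vs = wp vs \<otimes> a"
      using supports_commute[of a "wp vs"] not_adj_commute[of a] set no sp_reduced[OF r'] by auto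
    then have "v \<otimes> a = wp vs" using ve set by simp
    then have "a \<in> DR v" using lv lvs ve set by (simp add: DR_iff)
    then have "a = s" using mcr_iff[of "S - {s}" v] v d(4) set by auto
    then show False using no s by simp
  qed
qed

lemma mcr_sp_connected:
  assumes "v \<in> mcr (S - {s})"
  shows "cox_connected m (sp v)"
proof -
  have "\<lbrakk>reduced vs v; v \<in> mcr (S - {s})\<rbrakk> \<Longrightarrow> cox_connected m (set vs)" for vs v
  proof (induction vs arbitrary: v)
    case Nil
    then show ?case by (simp add: cox_connected_def)
  next
    case (Cons a vs)
    show ?case
    proof (cases "vs = []")
      case True
      then show ?thesis by (simp add: cox_connected_def)
    next
      case False
      note c = mcr_reduced_Cons[OF Cons.prems False]
      have conn: "cox_connected m (set vs)" using Cons.IH c by blast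
      have set: "a \<in> S" "set vs \<subseteq> S" using reducedD[OF Cons.prems(1)] by auto
      show ?thesis
      proof (cases "a \<in> set vs")
        case True
        then show ?thesis using conn by (simp add: insert_absorb)
      next
        case False
        then obtain r where "r \<in> set vs" "cox_adj m a r" using c(4) by blast
        then show ?thesis using cox_connected_insert[OF conn] adj_sym set by auto
      qed
    qed
  qed
  then show ?thesis using assms ex_reduced mcr_closed sp_reduced by metis
qed

text \<open>The last letter of a nonempty reduced word of \<open>v\<close> is \<open>s\<close>,
  which enters because it touches \<open>r\<close>. Going left, each letter repeats or touches one
  already absorbed.\<close>

lemma mcr_subset_qsp:
  assumes v: "v \<in> mcr (S - {s})" and x: "x \<in> carrier G" and add: "len (v \<otimes> x) = len v + len x"
    and r: "r \<in> qsp t x" "cox_adj m s r"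
  shows "sp v \<subseteq> qsp t (v \<otimes> x)"
proof -
  have main: "\<lbrakk>reduced vs (wp vs); wp vs \<in> mcr (S - {s}); len (wp vs \<otimes> x) = length vs + len x\<rbrakk> \<Longrightarrow>
    set vs \<subseteq> qsp t (wp vs \<otimes> x)" for vs
  proof (induction vs)
    case (Cons a vs)
    have set: "a \<in> S" "set vs \<subseteq> S" using reducedD[OF Cons.prems(1)] by auto
    define z where "z = wp vs \<otimes> x"
    have z: "z \<in> carrier G" using set x by (simp add: z_def)
    note ac = additive_Cons[OF reducedD(1)[OF Cons.prems(1)] x Cons.prems(3), folded z_def]
    show ?case
    proof (cases "vs = []")
      case True
      then have "a = s" using mcr_reduced_singleton[of a] Cons.prems by blast
      then show ?thesis
        using True qsp_step_adj[of s x r t] r x set ac(3) by (simp add: z_def)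
    next
      case False
      note c = mcr_reduced_Cons[OF Cons.prems(1,2) False]
      have IH: "set vs \<subseteq> qsp t z" using Cons.IH[OF c(1,2)] ac(1) by (simp add: z_def)
      have sub: "qsp t z \<subseteq> qsp t (a \<otimes> z)" using qsp_step[OF set(1) z ac(3), of t] by blast
      have "a \<in> qsp t (a \<otimes> z)"
        using c(4) IH sub qsp_step_adj[OF set(1) z ac(3), of _ t] by blast
      then show ?thesis unfolding ac(2) list.set using IH sub by blast
    qed
  qed simp
  obtain vs where vs: "reduced vs v" using v mcr_closed ex_reduced by metis
  then have "wp vs = v" "length vs = len v" using reducedD by blast+
  then show ?thesis using main[of vs] vs v add sp_reduced[OF vs] by simp
qed

text \<open>Apply \<open>qsp_step\<close> to \<open>u = r (r u)\<close>: if \<open>r\<close> stayed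
  outside, it would commute with its neighbour \<open>q\<close>.\<close>

lemma DL_qsp_adj:
  assumes u: "u \<in> carrier G" and r: "r \<in> DL u" and q: "q \<in> qsp t u" "cox_adj m r q"
  shows "r \<in> qsp t u"
proof -
  have rS: "r \<in> S" "len (r \<otimes> u) < len (r \<otimes> (r \<otimes> u))" using r u by (auto simp: DL_iff)
  have "q \<in> S" using sp_subset_S[OF rep_closed[OF u]] q by blast
  then have "q \<otimes> r \<noteq> r \<otimes> q" using adj_not_commute[of r q] rS q by metis
  moreover have "r \<otimes> (r \<otimes> u) = u" using rS u by simp
  ultimately show ?thesis using qsp_step[of r "r \<otimes> u" t] rS u q by auto
qed

lemma DL_qsp_self:
  assumes "u \<in> carrier G" "t \<in> DL u"
  shows "t \<in> qsp t u"
  using qsp_step_self[of t "t \<otimes> u"] assms by (auto simp: DL_iff)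

lemma connected_DL_subset_qsp:
  assumes "u \<in> carrier G" "cox_connected m B" "B \<subseteq> DL u" "t \<in> B"
  shows "B \<subseteq> qsp t u"
proof (rule cox_connected_closed[OF assms(2,4)])
  show "t \<in> qsp t u" using DL_qsp_self assms by blast
next
  fix x r assume *: "x \<in> qsp t u" "x \<in> B" "r \<in> B" "cox_adj m x r"
  then have "x \<in> S" "r \<in> S" using assms by (auto simp: DL_iff)
  then show "r \<in> qsp t u" using DL_qsp_adj[of u r x t] adj_sym[of x r] * assms by blast
qed

lemma bp_subset_qsp:
  assumes v: "v \<in> mcr (S - {s})" and u: "u \<in> generate G (S - {s})"
    and bp: "sp v - {s} \<subseteq> DL u" and t: "t \<in> sp v"
  shows "sp v \<subseteq> qsp t (v \<otimes> u)"
proof (cases "t = s")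
  case True
  then show ?thesis using rep_eq v u by simp
next
  case False
  have c: "v \<in> carrier G" "u \<in> carrier G" using v u mcr_closed generate_closed[of "S - {s}"] by auto
  have s: "s \<in> sp v" using mcr_last[OF v] t by (metis empty_iff sp_one)
  have SS: "sp v \<subseteq> S" using c by simp
  have "sp u \<subseteq> S - {s}" using sp_subset_iff[of u "S - {s}"] u c by auto
  then have snot: "s \<notin> qsp t u" using qsp_subset_sp[OF c(2), of t] by auto
  \<comment> \<open>Without a neighbour of \<open>s\<close> in \<open>qsp t u\<close>, each letter
    of \<open>sp v\<close> adjacent to that set would be a descent of \<open>u\<close> and so belong
    to it. The set would then swallow \<open>sp v\<close> including \<open>s\<close>, which is not
    in the support of \<open>u\<close>.\<close>
  have "\<exists>e\<in>qsp t u. cox_adj m s e"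
  proof (rule ccontr)
    assume no: "\<not> (\<exists>e\<in>qsp t u. cox_adj m s e)"
    have "sp v \<subseteq> qsp t u"
    proof (rule cox_connected_closed[OF mcr_sp_connected[OF v] t])
      show "t \<in> qsp t u" using DL_qsp_self c bp t False by blast
    next
      fix x r assume *: "x \<in> qsp t u" "x \<in> sp v" "r \<in> sp v" "cox_adj m x r"
      then have adj: "cox_adj m r x" using adj_sym SS by blast
      then have "r \<in> DL u" using no * bp by blast
      then show "r \<in> qsp t u" using DL_qsp_adj[OF c(2)] * adj by blast
    qed
    then show False using s snot by blast
  qed
  moreover have "len (v \<otimes> u) = len v + len u" using mcr_additive[of "S - {s}"] v u by auto
  ultimately show ?thesis using mcr_subset_qsp[OF v c(2)] by blast
qed

text \<open>For a nearly-maximal \<open>w = v u\<close> the inclusion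
  \<open>sp u \<subset> sp v\<close> gives \<open>sp w = sp v\<close>, and \<open>J\<close> omits a
  single letter \<open>q\<close> of it, so the decomposition is one with respect to
  \<open>S - {q}\<close> and \<open>bp_subset_qsp\<close> applies. For a maximal \<open>w\<close>
  every letter of the support is a left descent.\<close>

lemma nearly_maximal_qsp:
  assumes w: "w \<in> carrier G" and mx: "maximal_elt G S w \<or> nearly_maximal_elt G S w"
    and conn: "cox_connected m (sp w)" and s: "s \<in> sp w"
  shows "sp w \<subseteq> qsp s w"
  using mx
proof
  assume m: "maximal_elt G S w"
  then have "sp w \<subseteq> DL w"
    using longest_elt_props(2)[of "sp w"] w by (metis maximal_elt_def sp_subset_S)
  then show ?thesis using connected_DL_subset_qsp[OF w conn _ s] by blast
next
  assume "nearly_maximal_elt G S w"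
  then obtain J v u where d: "v \<in> mcr J" "u \<in> generate G J" "w = v \<otimes> u"
    "sp v \<inter> J \<subseteq> DL u" "J \<subseteq> sp w" "Suc (card J) = card (sp w)" "sp u \<subset> sp v"
    unfolding nearly_maximal_elt_def grassmannian_bp_decomp_def bp_decomp_def parabolic_decomp_def
    by blast
  have J: "J \<subseteq> S" using d(5) sp_subset_S[OF w] by blast
  have c: "v \<in> carrier G" "u \<in> carrier G" using d mcr_closed generate_closed J by auto
  have spw: "sp w = sp v" using sp_mult[OF c mcr_additive[OF J d(1,2)]] d(3,7) by auto
  have "card (sp w - J) = 1" using d(5,6) finite_sp[OF w] by (simp add: card_Diff_subset finite_subset)
  then obtain q where q: "sp w - J = {q}" by (metis card_1_singletonE)
  have "v \<in> mcr (S - {q})"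
  proof -
    have "DR v \<inter> J = {}" using mcr_iff[OF J c(1)] d(1) by blast
    then have "DR v \<subseteq> {q}" using DR_subset_sp[OF c(1)] spw q by blast
    then show ?thesis using mcr_iff[of "S - {q}" v] c by blast
  qed
  moreover have "u \<in> generate G (S - {q})"
    using d(2) mono_generate[of J "S - {q}"] J q by blast
  moreover have "sp v - {q} \<subseteq> DL u" using d(4,5) spw q by blast
  ultimately show ?thesis using bp_subset_qsp[of v q u s] s spw d(3) by simp
qed

section \<open>Right factors that are left-minimal for a parabolic subgroup\<close>

lemma left_min_additive:
  assumes J: "J \<subseteq> S" and x: "x \<in> carrier G" "DL x \<inter> J = {}" and g: "g \<in> generate G J"
  shows "len (g \<otimes> x) = len g + len x"
proof -
  have gc: "g \<in> carrier G" using g J generate_closed by blast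
  have "inv x \<in> mcr J" using mcr_iff[OF J, of "inv x"] x DR_inv[of "inv x"] by simp
  then have "len (inv x \<otimes> inv g) = len (inv x) + len (inv g)"
    using mcr_additive[OF J] generate_inv[OF J g] by blast
  moreover have "inv x \<otimes> inv g = inv (g \<otimes> x)" using x gc by (simp add: inv_mult_group)
  ultimately show ?thesis using x gc by simp
qed

text \<open>The factor \<open>x\<close> joins \<open>u\<close> and leaves \<open>v\<close>
  unchanged. For a letter \<open>t\<close> of \<open>v\<close>, both \<open>u\<close> and
  \<open>t u\<close> lie in \<open>W_B\<close>, so appending \<open>x\<close> adds
  \<open>len x\<close> to either and does not affect whether \<open>t\<close> is a descent.\<close>

lemma bp_mult_left_min:
  assumes l: "l \<in> carrier G" "sp l \<subseteq> B" "B \<subseteq> S" and x: "x \<in> carrier G" "DL x \<inter> B = {}" "s \<notin> sp x"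
  shows "s \<in> bp G S (l \<otimes> x) \<longleftrightarrow> s \<in> bp G S l"
proof -
  define v where "v = rep s l"
  obtain u where d: "v \<in> mcr (S - {s})" "u \<in> generate G (S - {s})" "u \<in> carrier G" "l = v \<otimes> u"
    using rep_decomp[OF l(1)] unfolding v_def by metis
  have vc: "v \<in> carrier G" using d mcr_closed by blast
  have "sp l = sp v \<union> sp u" using sp_mult[OF vc d(3)] mcr_additive[of "S - {s}" v u] d by auto
  then have sub: "sp v \<subseteq> B" "sp u \<subseteq> B" using l by auto
  then have uB: "u \<in> generate G B" using sp_subset_iff d l by blast
  have xg: "x \<in> generate G (S - {s})" using sp_subset_iff[of x "S - {s}"] sp_subset_S[OF x(1)] x by blast
  have lB: "l \<in> generate G B" using sp_subset_iff l by blast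
  have "sp (l \<otimes> x) = sp l \<union> sp x" using sp_mult[OF l(1) x(1)] left_min_additive[OF l(3) x(1,2) lB] by blast
  then have 1: "s \<in> sp (l \<otimes> x) \<longleftrightarrow> s \<in> sp l" using x by simp
  have 2: "t \<in> DL (u \<otimes> x) \<longleftrightarrow> t \<in> DL u" if "t \<in> sp v" for t
  proof -
    have t: "t \<in> B" "t \<in> S" using that sub l by auto
    have "t \<otimes> u \<in> generate G B" using generate_mult generate.incl t uB by metis
    then have "len (t \<otimes> u \<otimes> x) = len (t \<otimes> u) + len x" using left_min_additive[OF l(3) x(1,2)] by blast
    moreover have "len (u \<otimes> x) = len u + len x" using left_min_additive[OF l(3) x(1,2) uB] .
    ultimately show ?thesis using t d x by (simp add: DL_iff flip: m_assoc)
  qed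
  have "s \<in> bp G S (v \<otimes> (u \<otimes> x)) \<longleftrightarrow> s \<in> sp (v \<otimes> (u \<otimes> x)) \<and> sp v - {s} \<subseteq> DL (u \<otimes> x)"
    using bp_iff[OF d(1) generate_mult[OF d(2) xg]] .
  moreover have "v \<otimes> (u \<otimes> x) = l \<otimes> x" unfolding d(4) using vc d(3) x by (simp add: m_assoc)
  moreover have "s \<in> bp G S l \<longleftrightarrow> s \<in> sp l \<and> sp v - {s} \<subseteq> DL u"
    using bp_iff[OF d(1,2)] unfolding d(4)[symmetric] .
  ultimately show ?thesis using 1 2 by auto
qed

lemma rep_mult_right:
  assumes l: "l \<in> carrier G" and x: "x \<in> generate G (S - {s})"
  shows "rep s (l \<otimes> x) = rep s l"
proof -
  obtain u where d: "rep s l \<in> mcr (S - {s})" "u \<in> generate G (S - {s})" "u \<in> carrier G" "l = rep s l \<otimes> u"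
    using rep_decomp[OF l] by metis
  have xc: "x \<in> carrier G" using generate_closed[OF Diff_subset x] .
  have "l \<otimes> x = rep s l \<otimes> u \<otimes> x" using d(4) by simp
  also have "\<dots> = rep s l \<otimes> (u \<otimes> x)" using l d(3) xc by (intro m_assoc) auto
  finally show ?thesis using rep_eq[OF d(1) generate_mult[OF d(2) x]] by simp
qed

lemma DL_mult_commute:
  assumes y: "y \<in> carrier G" and z: "z \<in> carrier G" "s \<in> DL z" and add: "len (y \<otimes> z) = len y + len z"
    and comm: "\<And>t. t \<in> sp y \<Longrightarrow> s \<otimes> t = t \<otimes> s"
  shows "s \<in> DL (y \<otimes> z)"
proof -
  have s: "s \<in> S" "len (s \<otimes> z) < len z" using z by (auto simp: DL_iff)
  have sy: "s \<otimes> y = y \<otimes> s" using supports_commute[of s y] s y comm by auto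
  have "s \<otimes> (y \<otimes> z) = s \<otimes> y \<otimes> z" using s y z by (simp add: m_assoc)
  also have "\<dots> = y \<otimes> (s \<otimes> z)" unfolding sy using s y z by (simp add: m_assoc)
  finally have "len (s \<otimes> (y \<otimes> z)) \<le> len y + len (s \<otimes> z)" using len_mult[of y "s \<otimes> z"] s y z by simp
  then show ?thesis using s add by (simp add: DL_iff)
qed

end

section \<open>Labelled staircase diagrams\<close>

locale labelled_staircase = coxeter_system G S m
  for G (structure) and S :: "'a set" and m +
  fixes D :: "'a set set" and r :: "'a set rel" and lam :: "'a set \<Rightarrow> 'a"
  assumes staircase: "staircase_diagram S m D r"
    and labelled: "labelling G S D r lam"
begin

abbreviation JR :: "'a set \<Rightarrow> 'a set" where "JR \<equiv> J_R D r"
abbreviation lb :: "'a set \<Rightarrow> 'a" where "lb \<equiv> lambda_bar G S D r lam"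
abbreviation Lam :: "'a set list \<Rightarrow> 'a" where "Lam \<equiv> Lambda G S D r lam"

lemma order: "(B, B) \<in> r \<longleftrightarrow> B \<in> D" "(A, B) \<in> r \<Longrightarrow> (B, C) \<in> r \<Longrightarrow> (A, C) \<in> r"
  "(A, B) \<in> r \<Longrightarrow> (B, A) \<in> r \<Longrightarrow> A = B" "(A, B) \<in> r \<Longrightarrow> A \<in> D \<and> B \<in> D"
proof -
  have "partial_order_on D r" using staircase by (simp add: staircase_diagram_def)
  then have "refl_on D r" "trans r" "antisym r" "r \<subseteq> D \<times> D" by (auto dest: partial_order_onD)
  then show "(B, B) \<in> r \<longleftrightarrow> B \<in> D" "(A, B) \<in> r \<Longrightarrow> (B, C) \<in> r \<Longrightarrow> (A, C) \<in> r"
    "(A, B) \<in> r \<Longrightarrow> (B, A) \<in> r \<Longrightarrow> A = B" "(A, B) \<in> r \<Longrightarrow> A \<in> D \<and> B \<in> D"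
    by (auto simp: refl_on_def dest: transD antisymD)
qed

lemma block: "B \<in> D \<Longrightarrow> B \<subseteq> S" "B \<in> D \<Longrightarrow> cox_connected m B"
  using staircase by (auto simp: staircase_diagram_def)

lemma block_adj_chain:
  assumes "B \<in> D" "C \<in> D" "s \<in> B" "t \<in> C" "s = t \<or> cox_adj m s t"
  shows "(B, C) \<in> r \<or> (C, B) \<in> r"
proof -
  have "s \<in> S" "t \<in> S" using assms block by auto
  then have "is_chain r (blocks_at D s \<union> blocks_at D t)"
    using staircase assms(5) by (auto simp: staircase_diagram_def)
  then show ?thesis using assms by (auto simp: is_chain_def blocks_at_def)
qed

lemma block_saturated:
  assumes "(A, C) \<in> r" "(C, B) \<in> r" "s \<in> A" "s \<in> B" "t \<in> C" "cox_adj m s t"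
  shows "s \<in> C"
proof -
  have D: "A \<in> D" "B \<in> D" "C \<in> D" using assms order(4) by blast+
  then have "s \<in> S" "t \<in> S" using assms block by auto
  then have "saturated_in r (blocks_at D s) (blocks_at D s \<union> blocks_at D t)"
    using staircase assms(6) by (auto simp: staircase_diagram_def)
  then have "C \<in> blocks_at D s"
    using assms D unfolding saturated_in_def blocks_at_def by blast
  then show ?thesis by (simp add: blocks_at_def)
qed

lemma incomparable_blocks:
  assumes "B \<in> D" "C \<in> D" "(B, C) \<notin> r" "(C, B) \<notin> r" "s \<in> B" "t \<in> C"
  shows "s \<noteq> t" "s \<otimes> t = t \<otimes> s"
proof -
  have *: "\<not> (s = t \<or> cox_adj m s t)" using block_adj_chain assms by blast
  then show "s \<noteq> t" by blast
  show "s \<otimes> t = t \<otimes> s" using not_adj_commute[of s t] * assms block by blast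
qed

lemma JR_subset: "JR B \<subseteq> B"
  by (auto simp: J_R_def)

text \<open>The longest element \<open>u\<close> of \<open>JR B\<close> splits off
  \<open>lam B\<close> on the right because \<open>JR B\<close> consists of right descents, and what
  remains is \<open>lb B\<close>. As \<open>sp u \<subseteq> B\<close>, the full label has the same
  support as the truncated one.\<close>

lemma label:
  assumes B: "B \<in> D"
  defines "u \<equiv> longest_elt G S (JR B)"
  shows "lam B \<in> carrier G" "lb B \<in> carrier G" "u \<in> generate G (JR B)" "inv u = u" "JR B \<subseteq> DL u"
    "lb B \<in> mcr (JR B)" "len (lam B) = len (lb B) + len u" "lam B = lb B \<otimes> u"
    "sp (lb B) = B" "sp (lam B) = B" "J_L D r B \<subseteq> DL (lam B)"
proof -
  have l: "lam B \<in> carrier G" "spherical G (JR B)" "JR B \<subseteq> DR (lam B)" "sp (lb B) = B" "J_L D r B \<subseteq> DL (lam B)"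
    using labelled B by (auto simp: labelling_def lambda_bar_def)
  have J: "JR B \<subseteq> S" using block(1)[OF B] JR_subset by blast
  have lb: "lb B = lam B \<otimes> u" by (simp add: lambda_bar_def u_def)
  note p = longest_elt_props[OF J l(2), folded u_def]
  note q = full_right_descents_mcr[OF J l(2,1,3), folded u_def, folded lb]
  have uc: "u \<in> carrier G" using generate_closed[OF J p(1)] .
  show "lb B \<in> carrier G" using l uc lb by simp
  then have "sp (lb B \<otimes> u) = sp (lb B) \<union> sp u"
    using sp_mult[of "lb B" u] uc q(1) q(3)[symmetric] by simp
  moreover have "sp u \<subseteq> B" using sp_subset_iff[OF uc J] p(1) JR_subset by blast
  ultimately show "sp (lam B) = B" using l(4) q(3)[symmetric] by auto
  show "lam B \<in> carrier G" "u \<in> generate G (JR B)" "inv u = u" "JR B \<subseteq> DL u"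
    "lb B \<in> mcr (JR B)" "len (lam B) = len (lb B) + len u" "lam B = lb B \<otimes> u"
    "sp (lb B) = B" "J_L D r B \<subseteq> DL (lam B)"
    using l p q by blast+
qed

text \<open>Initial segments of linear extensions. Unlike \<open>linear_extension D r\<close>, the
  property passes to prefixes, so partial products can be treated by induction on the list.\<close>

definition lower_list :: "'a set list \<Rightarrow> bool" where
  "lower_list Bs \<longleftrightarrow> set Bs \<subseteq> D \<and> (\<forall>xs B ys. Bs = xs @ B # ys \<longrightarrow>
     B \<notin> set xs \<and> (\<forall>C\<in>D. (C, B) \<in> r \<and> C \<noteq> B \<longrightarrow> C \<in> set xs))"

lemma lower_list_append: "lower_list (xs @ ys) \<Longrightarrow> lower_list xs"
  unfolding lower_list_def by auto

lemma lower_list_split: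
  assumes "lower_list (xs @ B # ys)"
  shows "B \<in> D" "B \<notin> set xs" "B \<notin> set ys" "(C, B) \<in> r \<Longrightarrow> C \<noteq> B \<Longrightarrow> C \<in> set xs"
    "C \<in> set ys \<Longrightarrow> (C, B) \<notin> r" "C \<in> set xs \<Longrightarrow> (B, C) \<notin> r"
proof -
  have split: "B' \<notin> set xs' \<and> (\<forall>C\<in>D. (C, B') \<in> r \<and> C \<noteq> B' \<longrightarrow> C \<in> set xs')"
    if "xs @ B # ys = xs' @ B' # ys'" for xs' B' ys'
    using assms that unfolding lower_list_def by blast
  show B: "B \<in> D" "B \<notin> set xs" using assms split[of xs B ys] by (auto simp: lower_list_def)
  have ys: "C \<notin> set xs \<and> C \<noteq> B" if "C \<in> set ys" for C
  proof -
    obtain as bs where "ys = as @ C # bs" using \<open>C \<in> set ys\<close> split_list by metis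
    then show ?thesis using split[of "xs @ B # as" C bs] by auto
  qed
  then show "B \<notin> set ys" by blast
  show 1: "(C, B) \<in> r \<Longrightarrow> C \<noteq> B \<Longrightarrow> C \<in> set xs" for C
    using split[of xs B ys] order(4) by blast
  show "C \<in> set ys \<Longrightarrow> (C, B) \<notin> r" using ys 1 by blast
  show "C \<in> set xs \<Longrightarrow> (B, C) \<notin> r"
  proof
    assume "C \<in> set xs" "(B, C) \<in> r"
    moreover obtain as bs where "xs = as @ C # bs" using \<open>C \<in> set xs\<close> split_list by metis
    ultimately show False using split[of as C "bs @ B # ys"] B by auto
  qed
qed

lemma linear_extension_lower_list:
  assumes "linear_extension D r Bs"
  shows "lower_list Bs" "set Bs = D"
proof -
  show D: "set Bs = D" using assms by (simp add: linear_extension_def)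
  have "B \<notin> set xs \<and> (\<forall>C\<in>D. (C, B) \<in> r \<and> C \<noteq> B \<longrightarrow> C \<in> set xs)" if e: "Bs = xs @ B # ys" for xs B ys
  proof (intro conjI ballI impI)
    show "B \<notin> set xs" using assms e by (auto simp: linear_extension_def)
    fix C assume C: "C \<in> D" "(C, B) \<in> r \<and> C \<noteq> B"
    then obtain i where i: "i < length Bs" "Bs ! i = C" using D by (metis in_set_conv_nth)
    have l: "length xs < length Bs" "Bs ! length xs = B" using e by auto
    then have "i \<le> length xs" using assms i C unfolding linear_extension_def by metis
    moreover have "i \<noteq> length xs" using l i C by auto
    ultimately show "C \<in> set xs" using e i by (auto simp: nth_append)
  qed
  then show "lower_list Bs" using D by (simp add: lower_list_def)
qed

text \<open>Blocks sharing a letter are comparable and no block listed before \<open>B\<close> lies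
  above it. So a letter of \<open>B\<close> occurs earlier exactly if \<open>B\<close> is not the
  lowest block containing it.\<close>

lemma lower_list_inter:
  assumes "lower_list (xs @ [B])"
  shows "B \<inter> \<Union> (set xs) = JR B"
proof (intro equalityI subsetI)
  fix s assume "s \<in> B \<inter> \<Union> (set xs)"
  then obtain E where E: "s \<in> B" "s \<in> E" "E \<in> set xs" by blast
  then have "(B, E) \<notin> r" using lower_list_split(6)[OF assms] by blast
  moreover have "E \<in> blocks_at D s" using E assms by (auto simp: blocks_at_def lower_list_def)
  ultimately show "s \<in> JR B" using E by (auto simp: J_R_def is_minimum_def)
next
  fix s assume s: "s \<in> JR B"
  have B: "B \<in> D" using lower_list_split(1)[OF assms] .
  have sB: "s \<in> B" using s JR_subset by blast
  then obtain E where E: "E \<in> D" "s \<in> E" "(B, E) \<notin> r"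
    using s B by (auto simp: J_R_def is_minimum_def blocks_at_def)
  then have "(E, B) \<in> r" using block_adj_chain[OF E(1) B E(2) sB] by blast
  moreover have "E \<noteq> B" using E B order(1) by blast
  ultimately show "s \<in> B \<inter> \<Union> (set xs)" using lower_list_split(4)[OF assms] E sB by blast
qed

lemma Lam_Nil [simp]: "Lam [] = \<one>"
  by (simp add: Lambda_def)

lemma Lam_snoc: "Lam (xs @ [B]) = lb B \<otimes> Lam xs"
  by (simp add: Lambda_def)

lemma Lam_closed: "set xs \<subseteq> D \<Longrightarrow> Lam xs \<in> carrier G"
  by (induction xs rule: rev_induct) (auto simp: Lam_snoc label(2))

lemma lower_list_closed: "lower_list xs \<Longrightarrow> Lam xs \<in> carrier G"
  using Lam_closed by (simp add: lower_list_def)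

text \<open>The right descents of \<open>lb B\<close> lie in \<open>B\<close> but outside
  \<open>JR B\<close>, hence outside all earlier blocks, so \<open>lb B\<close> is minimal for the
  parabolic of the whole earlier part. The support hypothesis is discharged by
  \<open>Lam_support\<close>, whose induction uses this lemma in turn.\<close>

lemma Lam_support_additive:
  assumes "lower_list (xs @ [B])" "sp (Lam xs) = \<Union> (set xs)"
  shows "len (lb B \<otimes> Lam xs) = len (lb B) + len (Lam xs)"
proof -
  have B: "B \<in> D" using lower_list_split(1)[OF assms(1)] .
  have l: "lower_list xs" using lower_list_append assms(1) by blast
  have xc: "Lam xs \<in> carrier G" using lower_list_closed[OF l] .
  have sub: "\<Union> (set xs) \<subseteq> S" using assms(2) sp_subset_S[OF xc] by blast
  have "DR (lb B) \<subseteq> B" using DR_subset_sp[OF label(2)[OF B]] label(9)[OF B] by blast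
  moreover have "DR (lb B) \<inter> JR B = {}"
    using mcr_iff[of "JR B" "lb B"] label(2,6)[OF B] block(1)[OF B] JR_subset by blast
  ultimately have "DR (lb B) \<inter> \<Union> (set xs) = {}" using lower_list_inter[OF assms(1)] by blast
  then have "lb B \<in> mcr (\<Union> (set xs))" using mcr_iff[OF sub label(2)[OF B]] by blast
  moreover have "Lam xs \<in> generate G (\<Union> (set xs))" using sp_subset_iff[OF xc sub] assms(2) by blast
  ultimately show ?thesis using mcr_additive[OF sub] by blast
qed

lemma Lam_support: "lower_list xs \<Longrightarrow> sp (Lam xs) = \<Union> (set xs)"
proof (induction xs rule: rev_induct)
  case (snoc B xs)
  have l: "lower_list xs" using lower_list_append snoc.prems by blast
  have B: "B \<in> D" using lower_list_split(1)[OF snoc.prems] .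
  have "sp (lb B \<otimes> Lam xs) = sp (lb B) \<union> sp (Lam xs)"
    by (rule sp_mult[OF label(2)[OF B] lower_list_closed[OF l] Lam_support_additive[OF snoc.prems snoc.IH[OF l]]])
  then show ?case using snoc.IH[OF l] label(9)[OF B] by (auto simp: Lam_snoc)
qed simp

lemma Lam_additive:
  "lower_list (xs @ [B]) \<Longrightarrow> len (lb B \<otimes> Lam xs) = len (lb B) + len (Lam xs)"
  using Lam_support_additive Lam_support lower_list_append by blast

text \<open>Split \<open>Lam xs = u x\<close> with \<open>u\<close> the longest element of
  \<open>JR B\<close>; then \<open>lb B\<close> and \<open>u\<close> recombine to
  \<open>lam B\<close>. A left descent of \<open>x\<close> in \<open>B\<close> would lie in
  \<open>JR B\<close>, and cancelling it between \<open>u\<close> and \<open>x\<close> would give a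
  product too short for \<open>Lam xs\<close>.\<close>

lemma Lam_split_DL:
  assumes low: "lower_list (xs @ [B])" and DL: "JR B \<subseteq> DL (Lam xs)"
  obtains x where "x \<in> carrier G" "Lam (xs @ [B]) = lam B \<otimes> x"
    "len (Lam (xs @ [B])) = len (lam B) + len x" "DL x \<inter> B = {}" "sp x \<subseteq> \<Union> (set xs)"
proof -
  have B: "B \<in> D" using lower_list_split(1)[OF low] .
  have l: "lower_list xs" using lower_list_append low by blast
  have xc: "Lam xs \<in> carrier G" using lower_list_closed[OF l] .
  define u where "u = longest_elt G S (JR B)"
  note lab = label[OF B, folded u_def]
  have J: "JR B \<subseteq> S" using block(1)[OF B] JR_subset by blast
  have uc: "u \<in> carrier G" using generate_closed[OF J lab(3)] .
  have uu: "u \<otimes> u = \<one>" using r_inv[OF uc] lab(4) by simp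
  define x where "x = u \<otimes> Lam xs"
  have x: "x \<in> carrier G" using uc xc by (simp add: x_def)
  have len: "len (Lam xs) = len u + len x"
    using full_descents_left[OF J xc DL lab(3)] lab(4) by (simp add: x_def)
  have ux: "u \<otimes> x = Lam xs" using uc xc uu by (simp add: x_def flip: m_assoc)
  have 1: "Lam (xs @ [B]) = lam B \<otimes> x"
    unfolding Lam_snoc lab(8) ux[symmetric] using lab(2) uc x by (simp add: m_assoc)
  have 2: "len (Lam (xs @ [B])) = len (lam B) + len x"
    unfolding Lam_snoc using Lam_additive[OF low] lab(7) len by simp
  have "sp u \<subseteq> JR B" using sp_subset_iff[OF uc J] lab(3) by blast
  then have 3: "sp x \<subseteq> \<Union> (set xs)"
    using sp_mult_subset[OF uc xc] Lam_support[OF l] lower_list_inter[OF low] unfolding x_def by blast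
  have "DL x \<inter> B = {}"
  proof (rule ccontr)
    assume "DL x \<inter> B \<noteq> {}"
    then obtain t where t: "t \<in> DL x" "t \<in> B" by blast
    then have "t \<in> JR B" using DL_subset_sp[OF x] 3 lower_list_inter[OF low] by blast
    then have "t \<in> DR u" using lab(4,5) DR_inv[OF uc] by auto
    then have less: "t \<in> S" "len (u \<otimes> t) < len u" "len (t \<otimes> x) < len x"
      using t by (auto simp: DR_iff DL_iff)
    have "(u \<otimes> t) \<otimes> (t \<otimes> x) = Lam xs" using less uc x ux by (simp add: m_assoc)
    then have "len (Lam xs) \<le> len (u \<otimes> t) + len (t \<otimes> x)"
      using len_mult[of "u \<otimes> t" "t \<otimes> x"] less uc x by simp
    then show False using len less by simp
  qed
  then show thesis using that x 1 2 3 by blast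
qed

text \<open>Take the last earlier block \<open>E\<close> containing \<open>s\<close>. As
  \<open>B\<close> lies above it, \<open>s\<close> is in \<open>J_L D r E\<close>, hence a left
  descent of \<open>lam E\<close>, and by induction \<open>lam E\<close> is a left factor of the
  product up to \<open>E\<close>. The factors between \<open>E\<close> and \<open>B\<close> commute
  with \<open>s\<close>, so the descent survives.\<close>

lemma JR_subset_DL: "lower_list (xs @ [B]) \<Longrightarrow> JR B \<subseteq> DL (Lam xs)"
proof (induction "length xs" arbitrary: xs B rule: less_induct)
  case less
  show ?case
  proof
    fix s assume s: "s \<in> JR B"
    then have "s \<in> B" "\<exists>E\<in>set xs. s \<in> E" using lower_list_inter[OF less.prems] by auto
    then obtain xs1 E xs2 where e: "xs = xs1 @ E # xs2" "s \<in> E" "\<forall>C\<in>set xs2. s \<notin> C"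
      using split_list_last_prop[of xs "\<lambda>E. s \<in> E"] by blast
    have low: "lower_list (xs1 @ E # (xs2 @ [B]))" using less.prems e by simp
    have low1: "lower_list (xs1 @ [E])" using lower_list_append[of "xs1 @ [E]"] low by simp
    have D: "B \<in> D" "E \<in> D" using lower_list_split(1)[OF less.prems] lower_list_split(1)[OF low] by auto
    have "(B, E) \<notin> r" using lower_list_split(5)[OF low] by simp
    then have EB: "(E, B) \<in> r" using block_adj_chain[OF D \<open>s \<in> B\<close> e(2)] by blast
    have "JR E \<subseteq> DL (Lam xs1)" using less.hyps[of xs1 E] e low1 by simp
    then obtain x where x: "x \<in> carrier G" "Lam (xs1 @ [E]) = lam E \<otimes> x"
      "len (Lam (xs1 @ [E])) = len (lam E) + len x"
      using Lam_split_DL[OF low1] by metis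
    have "s \<in> J_L D r E"
      using e(2) D \<open>s \<in> B\<close> \<open>(B, E) \<notin> r\<close> by (auto simp: J_L_def is_maximum_def blocks_at_def)
    then have sl: "s \<in> S" "len (s \<otimes> lam E) < len (lam E)" using label(11)[OF D(2)] by (auto simp: DL_iff)
    have "s \<otimes> (lam E \<otimes> x) = s \<otimes> lam E \<otimes> x" using sl x label(1)[OF D(2)] by (simp add: m_assoc)
    then have "len (s \<otimes> (lam E \<otimes> x)) \<le> len (s \<otimes> lam E) + len x"
      using len_mult[of "s \<otimes> lam E" x] sl x label(1)[OF D(2)] by simp
    then have base: "s \<in> DL (Lam (xs1 @ [E]))" using sl x by (simp add: DL_iff)
    have "xs2 = zs @ ws \<Longrightarrow> s \<in> DL (Lam (xs1 @ [E] @ zs))" for zs ws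
    proof (induction zs arbitrary: ws rule: rev_induct)
      case Nil
      then show ?case using base by simp
    next
      case (snoc C zs)
      have IH: "s \<in> DL (Lam (xs1 @ [E] @ zs))" using snoc.IH[of "C # ws"] snoc.prems by simp
      have lC: "lower_list ((xs1 @ E # zs) @ C # (ws @ [B]))" using low snoc.prems by simp
      have lC': "lower_list ((xs1 @ [E] @ zs) @ [C])"
        using lower_list_append[of "(xs1 @ [E] @ zs) @ [C]"] lC by simp
      have C: "C \<in> D" "s \<notin> C" using lower_list_split(1)[OF lC] e(3) snoc.prems by auto
      have "(C, E) \<notin> r" "(B, C) \<notin> r"
        using lower_list_split(5)[OF low, of C] lower_list_split(5)[OF lC, of B] snoc.prems by auto
      \<comment> \<open>A letter of \<open>C\<close> adjacent to \<open>s\<close> would make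
        \<open>C\<close> comparable with both \<open>E\<close> and \<open>B\<close>; the listing
        order places \<open>C\<close> between them, and saturation would put \<open>s\<close> into
        \<open>C\<close>.\<close>
      then have nadj: "\<not> cox_adj m s t" if "t \<in> C" for t
        using block_adj_chain[of E C s t] block_adj_chain[of B C s t] block_saturated[of E C B s t]
          D C e(2) \<open>s \<in> B\<close> that by blast
      have comm: "s \<otimes> t = t \<otimes> s" if "t \<in> sp (lb C)" for t
        using not_adj_commute[OF sl(1)] nadj that label(9)[OF C(1)] block(1)[OF C(1)] by blast
      have "s \<in> DL (lb C \<otimes> Lam (xs1 @ [E] @ zs))"
        by (rule DL_mult_commute[OF label(2)[OF C(1)] lower_list_closed[OF lower_list_append[OF lC']]
              IH Lam_additive[OF lC'] comm])
      then show ?case using Lam_snoc[of "xs1 @ [E] @ zs" C] by simp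
    qed
    from this[of xs2 "[]"] show "s \<in> DL (Lam xs)" using e(1) by simp
  qed
qed

lemma Lam_split:
  assumes "lower_list (xs @ [B])"
  obtains x where "x \<in> carrier G" "Lam (xs @ [B]) = lam B \<otimes> x" "DL x \<inter> B = {}" "sp x \<subseteq> \<Union> (set xs)"
  using Lam_split_DL[OF assms JR_subset_DL[OF assms]] by metis

lemma in_generate_minus: "x \<in> carrier G \<Longrightarrow> s \<notin> sp x \<Longrightarrow> x \<in> generate G (S - {s})"
  using sp_subset_iff[of x "S - {s}"] sp_subset_S[of x] by blast

section \<open>The sets \<open>qsp\<close> along partial products\<close>

lemma qsp_Lam_mono:
  "lower_list (xs @ ys) \<Longrightarrow> qsp s (Lam xs) \<subseteq> qsp s (Lam (xs @ ys))"
proof (induction ys rule: rev_induct)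
  case (snoc C ys)
  have low: "lower_list ((xs @ ys) @ [C])" using snoc.prems by simp
  have l: "lower_list (xs @ ys)" using lower_list_append[OF low] .
  have "qsp s (Lam (xs @ ys)) \<subseteq> qsp s (lb C \<otimes> Lam (xs @ ys))"
    using qsp_mult(1)[OF label(2) lower_list_closed[OF l] Lam_additive[OF low]] lower_list_split(1)[OF low] by blast
  then show ?case using snoc.IH[OF l] Lam_snoc[of "xs @ ys" C] by simp
qed simp

text \<open>The letter \<open>t\<close> first occurs in \<open>C\<close>, so \<open>qsp t\<close>
  starts inside \<open>C\<close>. A later block \<open>E\<close> not above \<open>C\<close> is
  incomparable with every block above \<open>C\<close> listed before it; its factor commutes with
  the representative and disappears into the right-hand parabolic part.\<close>

lemma qsp_Lam_upper:
  assumes "lower_list (xs @ C # ys)" "t \<in> C" "t \<notin> \<Union> (set xs)"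
  shows "qsp t (Lam (xs @ C # ys)) \<subseteq> \<Union> {E \<in> set (xs @ C # ys). (C, E) \<in> r}"
  using assms(1)
proof (induction ys rule: rev_induct)
  case Nil
  have C: "C \<in> D" using lower_list_split(1)[OF Nil] .
  have l: "lower_list xs" using lower_list_append[OF Nil] .
  have "Lam xs \<in> generate G (S - {t})"
    using in_generate_minus[OF lower_list_closed[OF l]] Lam_support[OF l] assms(3) by blast
  then have "rep t (Lam (xs @ [C])) = rep t (lb C)"
    unfolding Lam_snoc using rep_mult_right label(2)[OF C] by blast
  then have "qsp t (Lam (xs @ [C])) \<subseteq> C" using qsp_subset_sp[OF label(2)[OF C], of t] label(9)[OF C] by simp
  then show ?case using order(1) C by auto
next
  case (snoc E ys)
  define zs where "zs = xs @ C # ys"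
  have low: "lower_list (zs @ [E])" using snoc.prems by (simp add: zs_def)
  have l: "lower_list zs" using lower_list_append[OF low] .
  have E: "E \<in> D" using lower_list_split(1)[OF low] .
  have zc: "Lam zs \<in> carrier G" using lower_list_closed[OF l] .
  have IH: "qsp t (Lam zs) \<subseteq> \<Union> {E \<in> set zs. (C, E) \<in> r}" using snoc.IH l by (simp add: zs_def)
  have step: "Lam (xs @ C # ys @ [E]) = lb E \<otimes> Lam zs" using Lam_snoc[of zs E] by (simp add: zs_def)
  have set: "set (xs @ C # ys @ [E]) = insert E (set zs)" by (auto simp: zs_def)
  show ?case
  proof (cases "(C, E) \<in> r")
    case True
    then show ?thesis
      unfolding step set using qsp_mult(2)[OF label(2)[OF E] zc Lam_additive[OF low], of t] IH label(9)[OF E] by blast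
  next
    case False
    have incomp: "(F, E) \<notin> r \<and> (E, F) \<notin> r" if "F \<in> set zs" "(C, F) \<in> r" for F
      using False order(2) that lower_list_split(6)[OF low] by blast
    have CD: "C \<in> D" "C \<in> set zs" using l by (auto simp: zs_def lower_list_def)
    then have tE: "t \<notin> E" using incomparable_blocks(1)[of C E t t] incomp[of C] order(1) assms(2) E by blast
    obtain u where d: "rep t (Lam zs) \<in> mcr (S - {t})" "u \<in> generate G (S - {t})" "u \<in> carrier G"
      "Lam zs = rep t (Lam zs) \<otimes> u" using rep_decomp[OF zc] by metis
    define v where "v = rep t (Lam zs)"
    have v: "v \<in> carrier G" "v \<in> mcr (S - {t})" "Lam zs = v \<otimes> u" using d zc by (auto simp: v_def)
    have "e \<otimes> f = f \<otimes> e" if ef: "e \<in> sp (lb E)" "f \<in> sp v" for e f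
    proof -
      obtain F where F: "F \<in> set zs" "(C, F) \<in> r" "f \<in> F" using ef IH by (auto simp: v_def)
      have "e \<in> E" using ef label(9)[OF E] by simp
      then show ?thesis using incomparable_blocks(2)[of E F e f] incomp[of F] F E order(4) by blast
    qed
    then have "lb E \<otimes> v = v \<otimes> lb E" using supports_commute label(2)[OF E] v(1) by blast
    then have "lb E \<otimes> Lam zs = v \<otimes> (lb E \<otimes> u)"
      unfolding v(3) using v(1) d(3) label(2)[OF E] by (simp flip: m_assoc)
    moreover have "lb E \<in> generate G (S - {t})" using in_generate_minus[OF label(2)[OF E]] label(9)[OF E] tE by blast
    ultimately have "rep t (lb E \<otimes> Lam zs) = v" using rep_eq[OF v(2) generate_mult] d(2) by simp
    then show ?thesis unfolding step set using IH by (auto simp: v_def)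
  qed
qed

text \<open>Some letter of \<open>C\<close> has \<open>C\<close> as its lowest block and so is not
  in \<open>B\<close>; hence the connected union has an edge leaving \<open>B\<close>, from
  \<open>b\<close> to \<open>t\<close>. A block of \<open>t\<close> strictly below \<open>C\<close>
  would lie below \<open>B\<close>, since nothing lies between, and saturation would put
  \<open>t\<close> into \<open>B\<close>.\<close>

lemma adjacent_cover:
  assumes cov: "covers D r C B"
  obtains b t where "b \<in> B" "t \<in> C" "t \<notin> B" "cox_adj m b t" "\<And>E. E \<in> D \<Longrightarrow> t \<in> E \<Longrightarrow> (C, E) \<in> r"
proof -
  have D: "B \<in> D" "C \<in> D" and BC: "(B, C) \<in> r" "B \<noteq> C"
    and mid: "\<And>E. (B, E) \<in> r \<Longrightarrow> (E, C) \<in> r \<Longrightarrow> E = B \<or> E = C"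
    using cov order(4) unfolding covers_def by blast+
  have conn: "cox_connected m (C \<union> B)" using cov staircase by (auto simp: staircase_diagram_def)
  obtain q where q: "q \<in> S" "is_minimum r (blocks_at D q) C"
    using staircase D by (auto simp: staircase_diagram_def)
  have "q \<in> C" "q \<notin> B"
    using q D BC order(3)[of B C] by (auto simp: is_minimum_def blocks_at_def)
  have "B \<noteq> {}" using staircase D by (auto simp: staircase_diagram_def)
  then obtain b0 where "b0 \<in> B" by blast
  have "\<exists>b\<in>B. \<exists>t\<in>C. t \<notin> B \<and> cox_adj m b t"
  proof (rule ccontr)
    assume "\<not> ?thesis"
    then have "C \<union> B \<subseteq> B" using cox_connected_closed[OF conn, of b0 B] \<open>b0 \<in> B\<close> by blast
    then show False using \<open>q \<in> C\<close> \<open>q \<notin> B\<close> by blast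
  qed
  then obtain b t where bt: "b \<in> B" "t \<in> C" "t \<notin> B" "cox_adj m b t" by blast
  have "(C, E) \<in> r" if E: "E \<in> D" "t \<in> E" for E
  proof (rule ccontr)
    assume no: "(C, E) \<notin> r"
    then have EC: "(E, C) \<in> r" "E \<noteq> C" using block_adj_chain[OF E(1) D(2) E(2) bt(2)] order(1) D by auto
    have "(B, E) \<notin> r" using mid EC bt E by blast
    then have EB: "(E, B) \<in> r" using block_adj_chain[OF D(1) E(1) bt(1) E(2)] bt(4) by blast
    have S: "b \<in> S" "t \<in> S" using block(1) D bt by auto
    show False using block_saturated[OF EB BC(1) E(2) bt(2) bt(1)] adj_sym[OF S] bt by blast
  qed
  then show thesis using that bt by blast
qed

text \<open>If \<open>C\<close> covers the first block \<open>B\<close> containing \<open>s\<close>, the support of the representative of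
  \<open>s\<close> contains \<open>B\<close> and reaches some \<open>t\<close> whose lowest block is \<open>C\<close>. The BP condition forces the
  support for \<open>t\<close> to be at least as large, but it only sees blocks above \<open>C\<close>.\<close>

lemma bp_Lam_first_block_max:
  assumes nm: "\<And>B. B \<in> D \<Longrightarrow> maximal_elt G S (lam B) \<or> nearly_maximal_elt G S (lam B)"
    and low: "lower_list (xs @ B # ys)" and all: "set (xs @ B # ys) = D"
    and s: "s \<in> B" "s \<notin> \<Union> (set xs)" and bp: "s \<in> bp G S (Lam (xs @ B # ys))"
  shows "B \<in> max_blocks D r"
proof (rule ccontr)
  assume no: "B \<notin> max_blocks D r"
  define w where "w = Lam (xs @ B # ys)"
  have B: "B \<in> D" using lower_list_split(1)[OF low] .
  then obtain C0 where C0: "C0 \<in> D" "(B, C0) \<in> r" "C0 \<noteq> B" using no by (auto simp: max_blocks_def)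
  then have "C0 \<in> set ys" using all lower_list_split(6)[OF low, of C0] by auto
  \<comment> \<open>The first listed block above \<open>B\<close> is a cover: anything strictly
    between would be listed before it.\<close>
  then obtain ys1 C ys2 where ys: "ys = ys1 @ C # ys2" "(B, C) \<in> r" "\<forall>E\<in>set ys1. (B, E) \<notin> r"
    using split_list_first_prop[of ys "\<lambda>E. (B, E) \<in> r"] C0 by blast
  define zs where "zs = xs @ B # ys1"
  have low2: "lower_list (zs @ C # ys2)" using low ys by (simp add: zs_def)
  have wz: "w = Lam (zs @ C # ys2)" by (simp add: w_def zs_def ys)
  have CB: "C \<noteq> B" using lower_list_split(3)[OF low] ys by auto
  have C: "C \<in> D" using lower_list_split(1)[OF low2] .
  have mid: "E = B \<or> E = C" if E: "(B, E) \<in> r" "(E, C) \<in> r" for E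
  proof (rule ccontr)
    assume ne: "\<not> (E = B \<or> E = C)"
    then have "E \<in> set zs" using lower_list_split(4)[OF low2 E(2)] by blast
    moreover have "E \<notin> set xs" using lower_list_split(6)[OF low] E(1) by blast
    ultimately show False using ne ys(3) E(1) by (auto simp: zs_def)
  qed
  have "covers D r C B" using B C CB ys(2) mid by (auto simp: covers_def)
  then obtain b t where bt: "b \<in> B" "t \<in> C" "t \<notin> B" "cox_adj m b t"
    and tmin: "\<And>E. E \<in> D \<Longrightarrow> t \<in> E \<Longrightarrow> (C, E) \<in> r"
    using adjacent_cover by metis

  have lowB: "lower_list (xs @ [B])" using lower_list_append[of "xs @ [B]" ys] low by simp
  have lowC: "lower_list (zs @ [C])" using lower_list_append[of "zs @ [C]" ys2] low2 by simp
  have lowz: "lower_list zs" using lower_list_append[OF low2] .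
  obtain x where x: "x \<in> carrier G" "Lam (xs @ [B]) = lam B \<otimes> x" "sp x \<subseteq> \<Union> (set xs)"
    using Lam_split[OF lowB] by metis
  \<comment> \<open>Since \<open>s\<close> first occurs in \<open>B\<close>, the factor
    \<open>x\<close> does not affect the representative. So \<open>qsp s\<close> can be computed
    from \<open>lam B\<close>, where near-maximality applies, instead of
    \<open>lb B\<close>.\<close>
  have "x \<in> generate G (S - {s})" using in_generate_minus[OF x(1)] x(3) s(2) by blast
  then have "rep s (Lam (xs @ [B])) = rep s (lam B)" using rep_mult_right[OF label(1)[OF B]] x(2) by simp
  moreover have "B \<subseteq> qsp s (lam B)"
    using nearly_maximal_qsp[OF label(1)[OF B] nm[OF B], of s] label(10)[OF B] block(2)[OF B] s(1) by simp
  moreover have "qsp s (Lam (xs @ [B])) \<subseteq> qsp s (Lam zs)"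
    using qsp_Lam_mono[of "xs @ [B]" ys1 s] lowz by (simp add: zs_def)
  ultimately have Bz: "B \<subseteq> qsp s (Lam zs)" by simp

  have S: "b \<in> S" "t \<in> S" using block(1) B C bt by auto
  have "t \<in> qsp s (lb C \<otimes> Lam zs)"
    using qsp_mult(3)[OF label(2)[OF C] lower_list_closed[OF lowz] Lam_additive[OF lowC], of t b s]
      label(9)[OF C] bt Bz adj_sym[OF S] by blast
  then have "t \<in> qsp s (Lam (zs @ [C]))" by (simp add: Lam_snoc)
  then have tw: "t \<in> qsp s w" using qsp_Lam_mono[of "zs @ [C]" ys2 s] low2 wz by auto
  have Bw: "B \<subseteq> qsp s w" using Bz qsp_Lam_mono[OF low2, of s] wz by blast

  have wc: "w \<in> carrier G" using lower_list_closed[OF low] by (simp add: w_def)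
  obtain u where d: "rep s w \<in> mcr (S - {s})" "u \<in> generate G (S - {s})" "u \<in> carrier G" "w = rep s w \<otimes> u"
    using rep_decomp[OF wc] by metis
  have "s \<in> bp G S (rep s w \<otimes> u)" using bp d(4) by (simp add: w_def)
  then have "qsp s w - {s} \<subseteq> DL u" using bp_iff[OF d(1,2)] by blast
  then have sub: "qsp s w \<subseteq> qsp t w" using bp_subset_qsp[OF d(1,2) _ tw] d(4) by simp

  have "t \<notin> \<Union> (set zs)"
    using tmin lower_list_split(6)[OF low2] lowz unfolding lower_list_def by blast
  then have up: "qsp t w \<subseteq> \<Union> {E \<in> set (zs @ C # ys2). (C, E) \<in> r}"
    using qsp_Lam_upper[OF low2 bt(2)] wz by simp
  \<comment> \<open>The witness is a letter whose highest block is \<open>B\<close>: finding it in a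
    block above \<open>C\<close> would place \<open>C\<close> below \<open>B\<close>.\<close>
  obtain q where q: "q \<in> B" "\<And>E. E \<in> D \<Longrightarrow> q \<in> E \<Longrightarrow> (E, B) \<in> r"
    using staircase B by (auto simp: staircase_diagram_def is_maximum_def blocks_at_def)
  then obtain E where E: "(C, E) \<in> r" "q \<in> E" using Bw sub up by blast
  then have "(C, B) \<in> r" using q(2)[of E] order(2,4) by blast
  then show False using order(3) ys(2) CB by blast
qed

text \<open>A block listed after \<open>B\<close> is not above it by maximality, nor below it by the
  listing order, so its factor commutes with that of \<open>B\<close>. In last position
  \<open>B\<close> is accessible to \<open>Lam_split\<close>.\<close>

lemma max_block_last:
  assumes low: "lower_list (xs @ B # ys)" and mx: "B \<in> max_blocks D r"
  shows "lower_list (xs @ ys @ [B])" "Lam (xs @ B # ys) = Lam (xs @ ys @ [B])"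
proof -
  have B: "B \<in> D" "\<And>E. (B, E) \<in> r \<Longrightarrow> E = B" using mx order(4) by (auto simp: max_blocks_def)
  have "B' \<notin> set as \<and> (\<forall>C\<in>D. (C, B') \<in> r \<and> C \<noteq> B' \<longrightarrow> C \<in> set as)"
    if e: "xs @ ys @ [B] = as @ B' # bs" for as B' bs
  proof (cases "bs = []")
    case True
    then have "B' = B" "as = xs @ ys" using e by auto
    then show ?thesis using lower_list_split(2,3)[OF low] lower_list_split(4)[OF low] by auto
  next
    case False
    then obtain bs' where bs: "bs = bs' @ [B]" using e by (cases bs rule: rev_cases) auto
    then have e': "xs @ ys = as @ B' # bs'" using e by simp
    then consider cs where "xs = as @ B' # cs" | cs where "as = xs @ cs" "ys = cs @ B' # bs'"
      by (auto simp: append_eq_append_conv2 Cons_eq_append_conv append_eq_Cons_conv)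
    then show ?thesis
    proof cases
      case 1
      then have l: "lower_list (as @ B' # (cs @ B # ys))" using low by simp
      show ?thesis using lower_list_split(2)[OF l] lower_list_split(4)[OF l] by blast
    next
      case 2
      then have l: "lower_list ((xs @ B # cs) @ B' # bs')" using low by simp
      have "B' \<noteq> B" using lower_list_split(2)[OF l] by auto
      then have "(B, B') \<notin> r" using B by blast
      then show ?thesis using lower_list_split(2)[OF l] lower_list_split(4)[OF l] 2 by auto
    qed
  qed
  moreover have "set (xs @ ys @ [B]) \<subseteq> D" using low by (auto simp: lower_list_def)
  ultimately show "lower_list (xs @ ys @ [B])" unfolding lower_list_def by blast
  show "Lam (xs @ B # ys) = Lam (xs @ ys @ [B])"
    using low
  proof (induction ys rule: rev_induct)
    case (snoc C ys)
    have l: "lower_list ((xs @ B # ys) @ [C])" using snoc.prems by simp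
    have C: "C \<in> D" "(C, B) \<notin> r" "(B, C) \<notin> r"
      using lower_list_split(1)[OF l] lower_list_split(5)[OF snoc.prems, of C]
        lower_list_split(2)[OF l] B(2)[of C] by auto
    have c: "lb B \<in> carrier G" "lb C \<in> carrier G" using label(2) B C by auto
    have z: "Lam (xs @ ys) \<in> carrier G" using snoc.prems by (intro Lam_closed) (auto simp: lower_list_def)
    have comm: "lb C \<otimes> lb B = lb B \<otimes> lb C"
      using supports_commute[OF c(2,1)] incomparable_blocks(2)[OF C(1) B(1) C(2,3)]
        label(9)[OF B(1)] label(9)[OF C(1)] by blast
    have "Lam (xs @ B # ys @ [C]) = lb C \<otimes> (lb B \<otimes> Lam (xs @ ys))"
      using snoc.IH lower_list_append[OF l] Lam_snoc[of "xs @ B # ys" C] Lam_snoc[of "xs @ ys" B] by simp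
    also have "\<dots> = lb B \<otimes> lb C \<otimes> Lam (xs @ ys)" using c z comm by (simp flip: m_assoc)
    also have "\<dots> = lb B \<otimes> (lb C \<otimes> Lam (xs @ ys))" using c z by (simp add: m_assoc)
    also have "\<dots> = Lam (xs @ (ys @ [C]) @ [B])"
      using Lam_snoc[of "xs @ ys" C] Lam_snoc[of "xs @ ys @ [C]" B] by simp
    finally show ?case .
  qed simp
qed

text \<open>With \<open>B\<close> moved last, \<open>Lam_split\<close> exposes \<open>lam B\<close>
  as a left factor. A letter of \<open>B\<close> outside \<open>JR B\<close> lies in no earlier
  block, hence not in the support of the remaining factor, as \<open>bp_mult_left_min\<close>
  requires.\<close>

lemma bp_Lam_max_block:
  assumes low: "lower_list Bs" and B: "B \<in> set Bs" "B \<in> max_blocks D r" and s: "s \<in> B" "s \<notin> JR B"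
  shows "s \<in> bp G S (Lam Bs) \<longleftrightarrow> s \<in> bp G S (lam B)"
proof -
  obtain xs ys where e: "Bs = xs @ B # ys" using B split_list by metis
  have low': "lower_list ((xs @ ys) @ [B])" and Lam: "Lam Bs = Lam ((xs @ ys) @ [B])"
    using max_block_last[of xs B ys] low e B by auto
  have BD: "B \<in> D" using lower_list_split(1)[OF low'] .
  obtain x where x: "x \<in> carrier G" "Lam ((xs @ ys) @ [B]) = lam B \<otimes> x" "DL x \<inter> B = {}"
    "sp x \<subseteq> \<Union> (set (xs @ ys))"
    using Lam_split[OF low'] by metis
  have "s \<notin> sp x" using lower_list_inter[OF low'] x(4) s by blast
  then show ?thesis
    using bp_mult_left_min[OF label(1)[OF BD] _ block(1)[OF BD] x(1,3)] label(10)[OF BD] Lam x(2) by simp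
qed

text \<open>For \<open>s\<close> on the left-hand side the witness is the first listed block
  containing it: that block has to be maximal, and being first keeps \<open>s\<close> out of
  \<open>JR B\<close>.\<close>

theorem bp_Lam:
  assumes nm: "\<And>B. B \<in> D \<Longrightarrow> maximal_elt G S (lam B) \<or> nearly_maximal_elt G S (lam B)"
    and low: "lower_list Bs" and all: "set Bs = D"
  shows "bp G S (Lam Bs) = (\<Union>B\<in>max_blocks D r. bp G S (lam B) - JR B)"
proof (intro equalityI subsetI)
  fix s assume s: "s \<in> bp G S (Lam Bs)"
  then have "s \<in> \<Union> (set Bs)" using Lam_support[OF low] by (auto simp: bp_def)
  then obtain xs B ys where e: "Bs = xs @ B # ys" "s \<in> B" "\<forall>E\<in>set xs. s \<notin> E"
    using split_list_first_prop[of Bs "\<lambda>B. s \<in> B"] by blast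
  have mx: "B \<in> max_blocks D r"
    using bp_Lam_first_block_max[OF nm, of xs B ys s] low all e s by auto
  have "lower_list (xs @ [B])" using lower_list_append[of "xs @ [B]" ys] low e by simp
  then have sJ: "s \<notin> JR B" using lower_list_inter e by blast
  then have "s \<in> bp G S (lam B)" using bp_Lam_max_block[OF low _ mx e(2)] s e(1) by simp
  then show "s \<in> (\<Union>B\<in>max_blocks D r. bp G S (lam B) - JR B)" using mx sJ by blast
next
  fix s assume "s \<in> (\<Union>B\<in>max_blocks D r. bp G S (lam B) - JR B)"
  then obtain B where B: "B \<in> max_blocks D r" "s \<in> bp G S (lam B)" "s \<notin> JR B" by blast
  have BD: "B \<in> D" using B by (simp add: max_blocks_def)
  have "s \<in> B" using B(2) label(10)[OF BD] by (auto simp: bp_def)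
  then show "s \<in> bp G S (Lam Bs)" using bp_Lam_max_block[OF low _ B(1)] B BD all by simp
qed

end

theorem theorem4p6:
  fixes G :: "('a, 'b) monoid_scheme"
    and S :: "'a set"
    and m :: "'a \<Rightarrow> 'a \<Rightarrow> enat"
    and D :: "'a set set"
    and r :: "'a set rel"
    and lam :: "'a set \<Rightarrow> 'a"
    and Bs :: "'a set list"
  assumes "coxeter_system G S m"
    and "staircase_diagram S m D r"
    and "nearly_maximal_labelling G S D r lam"
    and "linear_extension D r Bs"
  shows "bp G S (Lambda G S D r lam Bs) =
           (\<Union>B\<in>max_blocks D r. bp G S (lam B) - J_R D r B)"
proof -
  interpret coxeter_system G S m by fact
  interpret labelled_staircase G S m D r lam
    using assms(2,3) by unfold_locales (auto simp: nearly_maximal_labelling_def)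
  show ?thesis
    using assms(3) linear_extension_lower_list[OF assms(4)]
    by (intro bp_Lam) (auto simp: nearly_maximal_labelling_def)
qed

end
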